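(* Let $\pi$ be a projective unitary representation of a countable group $G$ on a Hilbert space $H$. Suppose that $\bigcup_{i=1}^k\{\pi(g)\xi_i\}_{g\in G}$ is a Bessel sequence, and let $M=\overline{span}\bigcup_{i=1}^k\{\pi(g)\xi_i\}_{g\in G}$. Then there exists a vector $\vec\eta=(\eta_1,\dots,\eta_k)$ such that (i) $\bigcup_{i=1}^k\{\pi(g)\eta_i\}_{g\in G}$ is a Parseval frame for $M$, and (ii) $\Theta_{\vec\eta,\pi}(H)=[\Theta_{\vec\xi,\pi}(H)]$.
   Context: A projective unitary representation of $G$ on $H$ is a map $g\mapsto\pi(g)$ into unitaries with $\pi(g)\pi(h)=\mu(g,h)\pi(gh)$, $\mu:G\times G\to\mathbb{T}$. For $\xi\in H$, $\Theta_{\xi,\pi}(x)=\sum_{g\in G}\langle x,\pi(g)\xi\rangle\chi_g\in\ell^2(G)$ ($\{\chi_g\}$ the standard basis), and for $\vec\xi=(\xi_1,\dots,\xi_k)$, $\Theta_{\vec\xi,\pi}:H\to\ell^2(G)^{(k)}$, $\Theta_{\vec\xi,\pi}(x)=\Theta_{\xi_1,\pi}(x)\oplus\cdots\oplus\Theta_{\xi_k,\pi}(x)$. $[K]$ denotes the closed linear span of a set $K$. *)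

theory Defs
  imports "HOL-Analysis.Analysis" "HOL-Library.Function_Algebras"
begin

class chilbert = banach +
  fixes cscale :: "complex \<Rightarrow> 'a \<Rightarrow> 'a"
    and cinner :: "'a \<Rightarrow> 'a \<Rightarrow> complex"
  assumes cscale_add_right: "cscale a (x + y) = cscale a x + cscale a y"
    and cscale_add_left: "cscale (a + b) x = cscale a x + cscale b x"
    and cscale_cscale: "cscale a (cscale b x) = cscale (a * b) x"
    and cscale_of_real: "cscale (complex_of_real r) x = scaleR r x"
    and cinner_cnj: "cinner x y = cnj (cinner y x)"
    and cinner_add_left: "cinner (x + y) z = cinner x z + cinner y z"
    and cinner_cscale_left: "cinner (cscale a x) y = a * cinner x y"
    and norm_cinner: "norm x = sqrt (Re (cinner x x))"

abbreviation cspan :: "'a::chilbert set \<Rightarrow> 'a set" where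
  "cspan S \<equiv> module.span cscale S"

definition clinear :: "('a::chilbert \<Rightarrow> 'b::chilbert) \<Rightarrow> bool" where
  "clinear f \<longleftrightarrow> (\<forall>x y. f (x + y) = f x + f y) \<and> (\<forall>c x. f (cscale c x) = cscale c (f x))"

definition unitary :: "('a::chilbert \<Rightarrow> 'a) \<Rightarrow> bool" where
  "unitary U \<longleftrightarrow> clinear U \<and> surj U \<and> (\<forall>x y. cinner (U x) (U y) = cinner x y)"

text \<open>The group G is a type with a (not necessarily abelian) group structure,
written additively: \<open>g + h\<close> is the group product.
\<open>\<pi> g \<circ> \<pi> h = \<mu> g h \<cdot> \<pi> (g h)\<close> with \<open>\<mu>\<close> taking values in the unit circle.\<close>

definition proj_unitary_rep ::
  "('g::group_add \<Rightarrow> 'h::chilbert \<Rightarrow> 'h) \<Rightarrow> ('g \<Rightarrow> 'g \<Rightarrow> complex) \<Rightarrow> bool" where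
  "proj_unitary_rep \<pi> \<mu> \<longleftrightarrow>
     (\<forall>g. unitary (\<pi> g)) \<and> (\<forall>g h. cmod (\<mu> g h) = 1) \<and>
     (\<forall>g h x. \<pi> g (\<pi> h x) = cscale (\<mu> g h) (\<pi> (g + h) x))"

definition bessel :: "('i \<Rightarrow> 'h::chilbert) \<Rightarrow> 'i set \<Rightarrow> bool" where
  "bessel v I \<longleftrightarrow> (\<exists>B. \<forall>x. (\<lambda>j. (cmod (cinner x (v j)))\<^sup>2) summable_on I \<and>
                         (\<Sum>\<^sub>\<infinity>j\<in>I. (cmod (cinner x (v j)))\<^sup>2) \<le> B * (norm x)\<^sup>2)"

definition parseval_frame_for :: "('i \<Rightarrow> 'h::chilbert) \<Rightarrow> 'i set \<Rightarrow> 'h set \<Rightarrow> bool" where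
  "parseval_frame_for v I M \<longleftrightarrow> v ` I \<subseteq> M \<and>
     (\<forall>x\<in>M. ((\<lambda>j. (cmod (cinner x (v j)))\<^sup>2) has_sum (norm x)\<^sup>2) I)"

text \<open>Elements of \<open>\<ell>\<^sup>2(G)\<^sup>(\<^sup>k\<^sup>)\<close> are represented as functions \<open>i \<mapsto> (g \<mapsto> value)\<close>,
with components indexed by \<open>i \<in> {1..k}\<close> (zero outside), square summable.\<close>

definition Theta :: "nat \<Rightarrow> (nat \<Rightarrow> 'h::chilbert) \<Rightarrow> ('g \<Rightarrow> 'h \<Rightarrow> 'h) \<Rightarrow> 'h \<Rightarrow> nat \<Rightarrow> 'g \<Rightarrow> complex" where
  "Theta k \<xi> \<pi> x = (\<lambda>i g. if i \<in> {1..k} then cinner x (\<pi> g (\<xi> i)) else 0)"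

definition ell2k :: "nat \<Rightarrow> (nat \<Rightarrow> 'g \<Rightarrow> complex) set" where
  "ell2k k = {f. (\<forall>i g. i \<notin> {1..k} \<longrightarrow> f i g = 0) \<and>
                 (\<lambda>(i, g). (cmod (f i g))\<^sup>2) summable_on UNIV}"

definition l2norm :: "(nat \<Rightarrow> 'g \<Rightarrow> complex) \<Rightarrow> real" where
  "l2norm f = sqrt (\<Sum>\<^sub>\<infinity>(i, g)\<in>UNIV. (cmod (f i g))\<^sup>2)"

definition fscale :: "complex \<Rightarrow> (nat \<Rightarrow> 'g \<Rightarrow> complex) \<Rightarrow> (nat \<Rightarrow> 'g \<Rightarrow> complex)" where
  "fscale c f = (\<lambda>i g. c * f i g)"

definition closed_span_l2 :: "nat \<Rightarrow> (nat \<Rightarrow> 'g \<Rightarrow> complex) set \<Rightarrow> (nat \<Rightarrow> 'g \<Rightarrow> complex) set" where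
  "closed_span_l2 k K = {f \<in> ell2k k. \<forall>e>0. \<exists>s\<in>module.span fscale K. s \<in> ell2k k \<and> l2norm (f - s) < e}"

end

theory Submission
  imports Defs "HOL-Computational_Algebra.Polynomial"
begin

text \<open>
  After rescaling, the frame operator \<open>S\<close> of the orbit system satisfies \<open>0 \<le> S \<le> 1\<close>, and the
  vectors sought are \<open>\<eta>\<^sub>i = S\<^sup>-\<^sup>1\<^sup>/\<^sup>2 \<xi>\<^sub>i\<close>, so that \<open>\<Theta>\<^sub>\<eta>\<close> is the partial isometry in the
  polar decomposition of \<open>\<Theta>\<^sub>\<xi>\<close>. No spectral theorem is needed: the Newton iteration
  \<open>p\<^sub>n\<^sub>+\<^sub>1 = p\<^sub>n (1 + e\<^sub>n / 2)\<close>, \<open>e\<^sub>n = 1 - S p\<^sub>n\<^sup>2\<close>, starting from \<open>p\<^sub>0 = 1\<close>, produces polynomials in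
  \<open>1 - S\<close> with nonnegative coefficients. Positivity makes \<open>p\<^sub>n \<xi>\<^sub>i\<close> and \<open>\<Theta>\<^sub>\<xi> p\<^sub>n x\<close> Cauchy, because
  \<open>\<parallel>a\<^sub>m - a\<^sub>n\<parallel>\<^sup>2 \<le> \<parallel>a\<^sub>m\<parallel>\<^sup>2 - \<parallel>a\<^sub>n\<parallel>\<^sup>2\<close> for both sequences, and \<open>e\<^sub>n \<rightarrow> 0\<close> strongly on the closed span.
  The limit has the form of an orbit since polynomials in \<open>S\<close> commute with the representation.
\<close>

section \<open>Inner products\<close>

lemma cscale_one [simp]: "cscale 1 (x::'h::chilbert) = x"
  using cscale_of_real[of 1 x] by simp

lemma module_cscale: "module (cscale :: complex \<Rightarrow> 'h::chilbert \<Rightarrow> 'h)"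
  by unfold_locales (simp_all add: cscale_add_right cscale_add_left cscale_cscale)

lemma cinner_add_right: "cinner (x::'h::chilbert) (y + z) = cinner x y + cinner x z"
  by (metis cinner_add_left cinner_cnj complex_cnj_add)

lemma cinner_cscale_right: "cinner (x::'h::chilbert) (cscale a y) = cnj a * cinner x y"
  by (metis cinner_cscale_left cinner_cnj complex_cnj_mult)

lemma cinner_scaleR_left: "cinner (r *\<^sub>R (x::'h::chilbert)) y = of_real r * cinner x y"
  by (metis cinner_cscale_left cscale_of_real)

lemma cinner_scaleR_right: "cinner (x::'h::chilbert) (r *\<^sub>R y) = of_real r * cinner x y"
  by (metis cinner_cscale_right cscale_of_real complex_cnj_complex_of_real)

lemma cinner_zero_left [simp]: "cinner 0 (x::'h::chilbert) = 0"
  using cinner_add_left[of 0 0 x] by simp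

lemma cinner_zero_right [simp]: "cinner (x::'h::chilbert) 0 = 0"
  using cinner_add_right[of x 0 0] by simp

lemma cinner_diff_left: "cinner ((x::'h::chilbert) - y) z = cinner x z - cinner y z"
  using cinner_add_left[of "x - y" y z] by simp

lemma cinner_diff_right: "cinner (x::'h::chilbert) (y - z) = cinner x y - cinner x z"
  using cinner_add_right[of x "y - z" z] by simp

lemma cinner_sum_left: "cinner (sum f F) (x::'h::chilbert) = (\<Sum>j\<in>F. cinner (f j) x)"
  by (induction F rule: infinite_finite_induct) (auto simp: cinner_add_left)

lemma Re_cinner_self: "Re (cinner x x) = (norm (x::'h::chilbert))\<^sup>2"
proof -
  have "sqrt (Re (cinner x x)) \<ge> 0"
    using norm_ge_zero[of x] by (simp add: norm_cinner)
  then show ?thesis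
    by (simp add: norm_cinner)
qed

lemma cinner_self: "cinner x x = of_real ((norm (x::'h::chilbert))\<^sup>2)"
proof -
  have "Im (cinner x x) = 0"
    by (metis cinner_cnj cnj.simps(2) equal_neg_zero)
  then show ?thesis
    by (simp add: complex_eq_iff Re_cinner_self)
qed

lemma Re_cinner_commute: "Re (cinner (x::'h::chilbert) y) = Re (cinner y x)"
  by (metis cinner_cnj cnj.simps(1))

lemma norm_cscale: "norm (cscale c (x::'h::chilbert)) = cmod c * norm x"
proof -
  have "(norm (cscale c x))\<^sup>2 = Re (c * cnj c * of_real ((norm x)\<^sup>2))"
    unfolding Re_cinner_self[symmetric, of "cscale c x"]
    by (simp only: cinner_cscale_left cinner_cscale_right cinner_self[of x] mult_ac)
  also have "\<dots> = (cmod c * norm x)\<^sup>2"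
    by (simp add: complex_mult_cnj cmod_power2 power_mult_distrib del: of_real_power)
  finally show ?thesis
    by (simp add: power2_eq_iff_nonneg)
qed

text \<open>The triangle inequality comes with the normed space class, so the usual deduction is
  reversed: expand the square of \<open>norm (x + y)\<close> and compare it with that of
  \<open>norm x + norm y\<close>.\<close>

lemma Re_cinner_le: "Re (cinner (x::'h::chilbert) y) \<le> norm x * norm y"
proof -
  have "(norm (x + y))\<^sup>2 = (norm x)\<^sup>2 + 2 * Re (cinner x y) + (norm y)\<^sup>2"
    using Re_cinner_commute[of y x]
    by (simp add: cinner_add_left cinner_add_right flip: Re_cinner_self)
  moreover have "(norm (x + y))\<^sup>2 \<le> (norm x + norm y)\<^sup>2"
    by (simp add: norm_triangle_ineq power_mono)
  ultimately show ?thesis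
    by (simp add: power2_sum)
qed

text \<open>A unimodular factor rotates the inner product onto the nonnegative real axis without
  changing \<open>norm x\<close>.\<close>

lemma cmod_cinner_le: "cmod (cinner (x::'h::chilbert) y) \<le> norm x * norm y"
proof (cases "cinner x y = 0")
  case False
  define c where "c = cnj (sgn (cinner x y))"
  have c: "cmod c = 1"
    using False by (simp add: c_def norm_sgn)
  have "cinner (cscale c x) y = of_real (cmod (cinner x y))"
    using False complex_norm_square[of "cinner x y"]
    by (simp add: cinner_cscale_left c_def sgn_eq field_simps power2_eq_square)
  then have "cmod (cinner x y) = Re (cinner (cscale c x) y)"
    by simp
  also have "\<dots> \<le> norm x * norm y"
    using Re_cinner_le[of "cscale c x" y] c by (simp add: norm_cscale)
  finally show ?thesis .
qed simp

lemma bounded_linear_cinner_left: "bounded_linear (\<lambda>x::'h::chilbert. cinner x y)"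
  by (rule bounded_linear_intro[where K = "norm y"])
    (auto simp: cinner_add_left cinner_scaleR_left cmod_cinner_le scaleR_conv_of_real)

lemma bounded_linear_cscale: "bounded_linear (cscale c :: 'h::chilbert \<Rightarrow> 'h)"
  by (rule bounded_linear_intro[where K = "cmod c"])
    (auto simp: cscale_add_right cscale_cscale norm_cscale mult.commute simp flip: cscale_of_real)

lemma bounded_bilinear_cinner: "bounded_bilinear (cinner :: 'h::chilbert \<Rightarrow> 'h \<Rightarrow> complex)"
proof
  show "\<exists>K. \<forall>a b::'h. norm (cinner a b) \<le> norm a * norm b * K"
    by (intro exI[of _ 1]) (simp add: cmod_cinner_le)
qed (auto simp: cinner_add_left cinner_add_right cinner_scaleR_left cinner_scaleR_right
    scaleR_conv_of_real)

lemma tendsto_cinner: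
  assumes "(f \<longlongrightarrow> (x::'h::chilbert)) F" and "(g \<longlongrightarrow> y) F"
  shows "((\<lambda>n. cinner (f n) (g n)) \<longlongrightarrow> cinner x y) F"
  using bounded_bilinear.tendsto[OF bounded_bilinear_cinner assms] .

lemma chilbert_eqI:
  assumes "\<And>y. cinner x y = cinner (x'::'h::chilbert) y"
  shows "x = x'"
proof -
  have "cinner (x - x') (x - x') = 0"
    by (simp add: cinner_diff_left assms)
  then show ?thesis
    by (simp add: cinner_self)
qed

section \<open>Square summable families\<close>

definition sqsum :: "('i \<Rightarrow> complex) \<Rightarrow> bool" where
  "sqsum f \<longleftrightarrow> (\<lambda>j. (cmod (f j))\<^sup>2) summable_on UNIV"

text \<open>\<open>infsum\<close> is 0 on a family that is not summable, so the value is the l2 norm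
  only under \<open>sqsum\<close>.\<close>

definition nrm2 :: "('i \<Rightarrow> complex) \<Rightarrow> real" where
  "nrm2 f = sqrt (\<Sum>\<^sub>\<infinity>j. (cmod (f j))\<^sup>2)"

lemma L2_set_le_nrm2:
  assumes "sqsum f"
  shows "L2_set (\<lambda>j. cmod (f j)) F \<le> nrm2 f"
proof (cases "finite F")
  case True
  then show ?thesis
    unfolding L2_set_def nrm2_def
    by (intro real_sqrt_le_mono finite_sum_le_infsum) (use assms in \<open>auto simp: sqsum_def\<close>)
qed (simp add: nrm2_def infsum_nonneg)

text \<open>A nonnegative series converges once its finite partial sums are bounded. Norm estimates
  thereby reduce to finite index sets, and bounds survive pointwise limits.\<close>

lemma L2_set_bound_imp:
  assumes "\<And>F. finite F \<Longrightarrow> L2_set (\<lambda>j. cmod (f j)) F \<le> c"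
  shows "sqsum f" "nrm2 f \<le> c"
proof -
  have c: "c \<ge> 0"
    using assms[of "{}"] by simp
  have le: "(\<Sum>j\<in>F. (cmod (f j))\<^sup>2) \<le> c\<^sup>2" if "finite F" for F
    using assms[OF that] by (simp add: L2_set_def real_sqrt_le_iff' sum_nonneg c sqrt_le_D)
  show "sqsum f"
    unfolding sqsum_def using le
    by (intro nonneg_bdd_above_summable_on) (auto intro!: bdd_aboveI[of _ "c\<^sup>2"])
  then show "nrm2 f \<le> c"
    unfolding nrm2_def sqsum_def using le c
    by (intro real_le_lsqrt infsum_le_finite_sums) auto
qed

lemma nrm2_nonneg [simp]: "nrm2 f \<ge> 0"
  by (simp add: nrm2_def infsum_nonneg)

lemma nrm2_has_sum:
  assumes "sqsum f"
  shows "((\<lambda>j. (cmod (f j))\<^sup>2) has_sum (nrm2 f)\<^sup>2) UNIV"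
  using assms by (simp add: sqsum_def nrm2_def infsum_nonneg)

lemma cmod_le_nrm2:
  assumes "sqsum f"
  shows "cmod (f j) \<le> nrm2 f"
  using L2_set_le_nrm2[OF assms, of "{j}"] by simp

text \<open>Minkowski's inequality, lifted from the finite sums in \<open>L2_set\<close>.\<close>

lemma
  assumes "sqsum f" "sqsum g"
  shows sqsum_diff: "sqsum (\<lambda>j. f j - g j)"
    and nrm2_diff_le: "nrm2 (\<lambda>j. f j - g j) \<le> nrm2 f + nrm2 g"
proof -
  have "L2_set (\<lambda>j. cmod (f j - g j)) F \<le> nrm2 f + nrm2 g" for F
  proof -
    have "L2_set (\<lambda>j. cmod (f j - g j)) F \<le> L2_set (\<lambda>j. cmod (f j) + cmod (g j)) F"
      by (rule L2_set_mono) (auto simp: norm_triangle_ineq4)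
    also have "\<dots> \<le> L2_set (\<lambda>j. cmod (f j)) F + L2_set (\<lambda>j. cmod (g j)) F"
      by (rule L2_set_triangle_ineq)
    also have "\<dots> \<le> nrm2 f + nrm2 g"
      using L2_set_le_nrm2 assms by (metis add_mono)
    finally show ?thesis .
  qed
  then show "sqsum (\<lambda>j. f j - g j)" "nrm2 (\<lambda>j. f j - g j) \<le> nrm2 f + nrm2 g"
    by (rule L2_set_bound_imp)+
qed

lemma nrm2_le_diff:
  assumes "sqsum f" "sqsum g"
  shows "\<bar>nrm2 f - nrm2 g\<bar> \<le> nrm2 (\<lambda>j. f j - g j)"
proof -
  have *: "nrm2 (\<lambda>j. g j - f j) = nrm2 (\<lambda>j. f j - g j)"
    by (simp add: nrm2_def norm_minus_commute)
  have "nrm2 f \<le> nrm2 (\<lambda>j. f j - g j) + nrm2 (\<lambda>j. - g j)"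
    using nrm2_diff_le[OF sqsum_diff[OF assms], of "\<lambda>j. - g j"] assms by (simp add: sqsum_def)
  moreover have "nrm2 g \<le> nrm2 (\<lambda>j. g j - f j) + nrm2 (\<lambda>j. - f j)"
    using nrm2_diff_le[OF sqsum_diff[OF assms(2,1)], of "\<lambda>j. - f j"] assms by (simp add: sqsum_def)
  ultimately show ?thesis
    by (simp add: * nrm2_def abs_le_iff)
qed

section \<open>Cauchy criteria for series and sequences\<close>

text \<open>Sums over two finite sets containing \<open>F0\<close> differ only by terms outside
  \<open>F0\<close>, so the net of finite sums is Cauchy and completeness applies.\<close>

lemma summable_on_Cauchy_criterion:
  fixes f :: "'i \<Rightarrow> 'b::banach"
  assumes "\<And>e. e > 0 \<Longrightarrow> \<exists>F0. finite F0 \<and> F0 \<subseteq> A \<and>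
      (\<forall>F. finite F \<longrightarrow> F \<subseteq> A - F0 \<longrightarrow> norm (sum f F) < e)"
  shows "f summable_on A"
proof -
  have "\<exists>P. eventually P (finite_subsets_at_top A) \<and>
              (\<forall>F F'. P F \<and> P F' \<longrightarrow> dist (sum f F) (sum f F') < e)" if "e > 0" for e
  proof -
    obtain F0 where F0: "finite F0" "F0 \<subseteq> A"
      and small: "\<And>F. finite F \<Longrightarrow> F \<subseteq> A - F0 \<Longrightarrow> norm (sum f F) < e/2"
      using assms[of "e/2"] \<open>e > 0\<close> by (meson half_gt_zero)
    have "dist (sum f F) (sum f F') < e"
      if "finite F" "F0 \<subseteq> F" "F \<subseteq> A" "finite F'" "F0 \<subseteq> F'" "F' \<subseteq> A" for F F'
    proof -
      have "norm (sum f (F - F0)) < e/2" "norm (sum f (F' - F0)) < e/2"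
        using that by (intro small; auto)+
      moreover have "dist (sum f F) (sum f F') = norm (sum f (F - F0) - sum f (F' - F0))"
        using that by (simp add: sum_diff dist_norm)
      ultimately show ?thesis
        using norm_triangle_ineq4[of "sum f (F - F0)" "sum f (F' - F0)"] by linarith
    qed
    then show ?thesis
      using F0 by (intro exI[of _ "\<lambda>F. finite F \<and> F0 \<subseteq> F \<and> F \<subseteq> A"])
        (auto simp: eventually_finite_subsets_at_top)
  qed
  then have "cauchy_filter (filtermap (sum f) (finite_subsets_at_top A))"
    by (simp add: cauchy_filter_metric_filtermap)
  moreover have "complete (UNIV :: 'b set)"
    by (meson Cauchy_convergent UNIV_I complete_def convergent_def)
  ultimately obtain L where "(sum f \<longlongrightarrow> L) (finite_subsets_at_top A)"
    using complete_uniform[where S = UNIV] by (force simp: filterlim_def)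
  then show ?thesis
    using summable_on_def has_sum_def by blast
qed

text \<open>The increments force \<open>b\<close> to increase; being bounded, it is Cauchy. Keeping
  \<open>d\<close> abstract covers both the norm of H and \<open>nrm2\<close>.\<close>

lemma increments_bounded_imp_small:
  fixes b :: "nat \<Rightarrow> real"
  assumes le: "\<And>m n. n \<le> m \<Longrightarrow> d m n \<le> b m - b n" and nonneg: "\<And>m n. 0 \<le> d m n"
    and bound: "\<And>n. b n \<le> c" and "e > 0"
  shows "\<exists>N. \<forall>n\<ge>N. \<forall>m\<ge>n. d m n < e"
proof -
  have "b n \<le> b m" if "n \<le> m" for m n
    using le[OF that] nonneg[of m n] by linarith
  then have "incseq b"
    by (simp add: incseq_def)
  then have "Cauchy b"
    using bound incseq_convergent[of b c] by (metis LIMSEQ_imp_Cauchy)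
  then obtain N where N: "\<And>m n. m \<ge> N \<Longrightarrow> n \<ge> N \<Longrightarrow> norm (b m - b n) < e"
    using CauchyD \<open>e > 0\<close> by metis
  have "d m n < e" if "n \<ge> N" "m \<ge> n" for m n
    using le[OF that(2)] N[of m n] that by (auto simp: abs_less_iff)
  then show ?thesis
    by blast
qed

lemma increments_bounded_imp_convergent:
  fixes a :: "nat \<Rightarrow> 'b::banach"
  assumes le: "\<And>m n. n \<le> m \<Longrightarrow> (norm (a m - a n))\<^sup>2 \<le> b m - b n"
    and bound: "\<And>n. b n \<le> c"
  shows "convergent a"
proof -
  have "Cauchy a"
  proof (rule metric_CauchyI)
    fix e :: real
    assume "e > 0"
    then obtain N where N: "\<forall>n\<ge>N. \<forall>m\<ge>n. (norm (a m - a n))\<^sup>2 < e\<^sup>2"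
      using increments_bounded_imp_small[of "\<lambda>m n. (norm (a m - a n))\<^sup>2" b c "e\<^sup>2"] le bound
      by auto
    have *: "dist (a m) (a n) < e" if "n \<ge> N" "m \<ge> n" for m n
      using N that \<open>e > 0\<close> by (auto simp: dist_norm intro: power2_less_imp_less)
    have "dist (a m) (a n) < e" if "n \<ge> N" "m \<ge> N" for m n
      using *[of m n] *[of n m] that by (metis dist_commute nle_le)
    then show "\<exists>M. \<forall>m\<ge>M. \<forall>n\<ge>M. dist (a m) (a n) < e"
      by blast
  qed
  then show ?thesis
    by (rule Cauchy_convergent)
qed

section \<open>Newton iteration for the inverse square root\<close>

definition nonneg_poly :: "real poly \<Rightarrow> bool" where
  "nonneg_poly p \<longleftrightarrow> (\<forall>i. coeff p i \<ge> 0)"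

lemma nonneg_poly_add: "nonneg_poly p \<Longrightarrow> nonneg_poly q \<Longrightarrow> nonneg_poly (p + q)"
  by (simp add: nonneg_poly_def)

lemma nonneg_poly_mult: "nonneg_poly p \<Longrightarrow> nonneg_poly q \<Longrightarrow> nonneg_poly (p * q)"
  by (simp add: nonneg_poly_def coeff_mult sum_nonneg)

lemma nonneg_poly_pCons_iff: "nonneg_poly (pCons a p) \<longleftrightarrow> a \<ge> 0 \<and> nonneg_poly p"
  by (auto simp: nonneg_poly_def coeff_pCons split: nat.splits)

lemma nonneg_poly_0: "nonneg_poly 0"
  by (simp add: nonneg_poly_def)

lemma nonneg_poly_1: "nonneg_poly 1"
  by (simp add: nonneg_poly_def)

lemmas nonneg_poly_intros =
  nonneg_poly_add nonneg_poly_mult nonneg_poly_0 nonneg_poly_1 nonneg_poly_pCons_iff[THEN iffD2]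

abbreviation "spoly \<equiv> [:1, -1:] :: real poly"

text \<open>With \<open>s = 1 - X\<close>, the iterates approximate \<open>s\<^sup>-\<^sup>1\<^sup>/\<^sup>2\<close>, and \<open>resid\<close>
  measures the defect of \<open>s p\<^sup>2 = 1\<close>. Expanding in powers of \<open>X\<close> rather than \<open>s\<close> makes all
  coefficients nonnegative.\<close>

definition resid :: "real poly \<Rightarrow> real poly" where
  "resid p = 1 - spoly * (p * p)"

primrec newton :: "nat \<Rightarrow> real poly" where
  "newton 0 = 1"
| "newton (Suc n) = newton n * (1 + [:1/2:] * resid (newton n))"

lemma spoly_newton: "spoly * (newton n * newton n) = 1 - resid (newton n)"
  by (simp add: resid_def)

text \<open>With s p^2 = 1 - e this is 1 - (1 - e) (1 + e/2)^2 = e^2 (3 + e) / 4. The form on the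
  right shows that the next residual inherits nonnegative coefficients.\<close>

lemma resid_newton_Suc:
  "resid (newton (Suc n)) =
     [:1/4:] * (resid (newton n) * resid (newton n) * ([:3:] + resid (newton n)))"
proof -
  \<comment> \<open>Only \<open>2 * h = 1\<close> is kept about the constant 1/2, which leaves a
    commutative ring identity for \<open>algebra\<close>.\<close>
  define h where "h = [:1/2::real:]"
  define e p where "e = resid (newton n)" and "p = newton n"
  have h: "2 * h = 1" "[:1/4:] = h * h" "[:3::real:] = 3"
    by (simp_all add: h_def numeral_poly)
  have e: "spoly * (p * p) = 1 - e"
    by (simp only: e_def p_def spoly_newton)
  have "resid (p * (1 + h * e)) = 1 - (spoly * (p * p)) * ((1 + h * e) * (1 + h * e))"
    by (simp only: resid_def mult_ac)
  also have "\<dots> = h * h * (e * e * (3 + e))"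
    unfolding e using h(1) by algebra
  finally show ?thesis
    by (simp only: h newton.simps e_def p_def h_def[symmetric])
qed

lemma nonneg_resid_newton: "nonneg_poly (resid (newton n))"
proof (induction n)
  case 0
  have "resid (newton 0) = [:0, 1:]"
    by (simp add: resid_def one_pCons)
  then show ?case
    by (simp add: nonneg_poly_pCons_iff nonneg_poly_0)
next
  case (Suc n)
  then show ?case
    unfolding resid_newton_Suc by (intro nonneg_poly_intros) (auto simp: nonneg_poly_0)
qed

lemma newton_Suc_diff: "newton (Suc n) - newton n = [:1/2:] * (newton n * resid (newton n))"
  by (simp only: newton.simps) algebra

lemma nonneg_newton: "nonneg_poly (newton n)"
  by (induction n) (auto simp del: mult_pCons_left intro!: nonneg_poly_intros nonneg_resid_newton)

text \<open>Each Newton step adds p_n e_n / 2, a product of polynomials with nonnegative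
  coefficients.\<close>

lemma nonneg_newton_diff: "n \<le> m \<Longrightarrow> nonneg_poly (newton m - newton n)"
proof (induction m rule: dec_induct)
  case base
  then show ?case by (simp add: nonneg_poly_0)
next
  case (step m)
  have "nonneg_poly (newton (Suc m) - newton m)"
    unfolding newton_Suc_diff
    by (intro nonneg_poly_intros nonneg_newton nonneg_resid_newton) (auto simp: nonneg_poly_0)
  from nonneg_poly_add[OF this step.IH] show ?case
    by simp
qed

section \<open>The frame operator\<close>

text \<open>The Bessel bound is normalised to 1, which puts the frame operator S between 0 and
  1.\<close>

locale unit_bessel =
  fixes v :: "'i \<Rightarrow> 'h::chilbert"
  assumes sqsum_coeff: "sqsum (\<lambda>j. cinner x (v j))"
    and nrm2_coeff_le: "nrm2 (\<lambda>j. cinner x (v j)) \<le> norm x"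
begin

text \<open>Pair the sum u with itself, apply Cauchy-Schwarz over \<open>F\<close>, and bound the
  coefficients of u by the Bessel inequality for u; one factor \<open>norm u\<close>
  cancels.\<close>

lemma norm_synthesis_le:
  "norm (\<Sum>j\<in>F. cscale (cinner x (v j)) (v j)) \<le> L2_set (\<lambda>j. cmod (cinner x (v j))) F"
    (is "norm ?u \<le> ?L")
proof -
  have "(norm ?u)\<^sup>2 = Re (\<Sum>j\<in>F. cinner x (v j) * cinner (v j) ?u)"
    by (simp only: Re_cinner_self[symmetric] cinner_sum_left[of _ F ?u] cinner_cscale_left)
  also have "\<dots> \<le> cmod (\<Sum>j\<in>F. cinner x (v j) * cinner (v j) ?u)"
    by (rule complex_Re_le_cmod)
  also have "\<dots> \<le> (\<Sum>j\<in>F. cmod (cinner x (v j) * cinner (v j) ?u))"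
    by (rule norm_sum)
  also have "\<dots> = (\<Sum>j\<in>F. \<bar>cmod (cinner x (v j))\<bar> * \<bar>cmod (cinner ?u (v j))\<bar>)"
    by (intro sum.cong refl) (metis abs_norm_cancel cinner_cnj complex_mod_cnj norm_mult)
  also have "\<dots> \<le> ?L * L2_set (\<lambda>j. cmod (cinner ?u (v j))) F"
    by (rule L2_set_mult_ineq)
  also have "\<dots> \<le> ?L * norm ?u"
    by (intro mult_left_mono L2_set_nonneg order_trans[OF L2_set_le_nrm2 nrm2_coeff_le] sqsum_coeff)
  finally show ?thesis
    by (cases "norm ?u = 0") (auto simp: power2_eq_square)
qed

definition frame_op :: "'h \<Rightarrow> 'h" where
  "frame_op x = (\<Sum>\<^sub>\<infinity>j. cscale (cinner x (v j)) (v j))"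

text \<open>By \<open>norm_synthesis_le\<close>, tails of the vector series are controlled by tails
  of the convergent square sum.\<close>

lemma has_sum_frame_op: "((\<lambda>j. cscale (cinner x (v j)) (v j)) has_sum frame_op x) UNIV"
proof -
  have "(\<lambda>j. cscale (cinner x (v j)) (v j)) summable_on UNIV"
  proof (rule summable_on_Cauchy_criterion)
    fix e :: real
    assume "e > 0"
    define q where "q j = (cmod (cinner x (v j)))\<^sup>2" for j
    have q: "q summable_on UNIV"
      using sqsum_coeff[of x] by (simp add: sqsum_def q_def[abs_def])
    obtain F0 where F0: "finite F0" "dist (sum q F0) (infsum q UNIV) \<le> e\<^sup>2 / 2"
      using infsum_finite_approximation[OF q, of "e\<^sup>2/2"] \<open>e > 0\<close> by auto
    have "norm (\<Sum>j\<in>F. cscale (cinner x (v j)) (v j)) < e"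
      if "finite F" "F \<subseteq> UNIV - F0" for F
    proof -
      have "sum q (F0 \<union> F) \<le> infsum q UNIV"
        by (rule finite_sum_le_infsum[OF q]) (use that F0 in \<open>auto simp: q_def\<close>)
      moreover have "sum q (F0 \<union> F) = sum q F0 + sum q F"
        by (rule sum.union_disjoint) (use that F0 in auto)
      ultimately have "sum q F \<le> e\<^sup>2 / 2"
        using F0(2) unfolding dist_real_def by linarith
      then have "sum q F < e\<^sup>2"
        using \<open>e > 0\<close> zero_less_power[of e 2] by linarith
      then have "L2_set (\<lambda>j. cmod (cinner x (v j))) F < e"
        using \<open>e > 0\<close> by (auto simp: L2_set_def q_def intro: real_less_lsqrt)
      then show ?thesis
        using norm_synthesis_le order_le_less_trans by blast
    qed
    then show "\<exists>F0. finite F0 \<and> F0 \<subseteq> UNIV \<and>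
      (\<forall>F. finite F \<longrightarrow> F \<subseteq> UNIV - F0 \<longrightarrow> norm (\<Sum>j\<in>F. cscale (cinner x (v j)) (v j)) < e)"
      using F0 by blast
  qed
  then show ?thesis
    by (simp add: frame_op_def)
qed

lemma frame_op_add: "frame_op (x + y) = frame_op x + frame_op y"
  using has_sum_add[OF has_sum_frame_op[of x] has_sum_frame_op[of y]]
  by (intro has_sum_unique[OF has_sum_frame_op]) (simp add: cinner_add_left cscale_add_left)

lemma frame_op_cscale: "frame_op (cscale c x) = cscale c (frame_op x)"
  using has_sum_bounded_linear[OF bounded_linear_cscale[of c] has_sum_frame_op[of x]]
  by (intro has_sum_unique[OF has_sum_frame_op]) (simp add: cinner_cscale_left cscale_cscale)

lemma frame_op_scaleR: "frame_op (r *\<^sub>R x) = r *\<^sub>R frame_op x"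
  by (metis cscale_of_real frame_op_cscale)

lemma has_sum_cinner_frame_op:
  "((\<lambda>j. cinner x (v j) * cinner (v j) y) has_sum cinner (frame_op x) y) UNIV"
  using has_sum_bounded_linear[OF bounded_linear_cinner_left[of y] has_sum_frame_op[of x]]
  by (simp add: cinner_cscale_left)

lemma frame_op_adjoint: "cinner (frame_op x) y = cinner x (frame_op y)"
proof -
  have "((\<lambda>j. cnj (cinner y (v j) * cinner (v j) x)) has_sum cnj (cinner (frame_op y) x)) UNIV"
    using has_sum_cinner_frame_op[of y x] by (simp only: has_sum_cnj_iff)
  moreover have "cnj (cinner y (v j) * cinner (v j) x) = cinner x (v j) * cinner (v j) y" for j
    by (metis cinner_cnj complex_cnj_mult mult.commute)
  ultimately show ?thesis
    using has_sum_unique[OF has_sum_cinner_frame_op] by (metis (no_types, lifting) cinner_cnj has_sum_cong)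
qed

lemma Re_cinner_frame_op: "Re (cinner (frame_op x) x) = (nrm2 (\<lambda>j. cinner x (v j)))\<^sup>2"
proof -
  have "cinner x (v j) * cinner (v j) x = of_real ((cmod (cinner x (v j)))\<^sup>2)" for j
    by (metis cinner_cnj complex_norm_square)
  then have "((\<lambda>j. of_real ((cmod (cinner x (v j)))\<^sup>2)) has_sum cinner (frame_op x) x) UNIV"
    using has_sum_cinner_frame_op[of x x] by simp
  then have "((\<lambda>j. Re (of_real ((cmod (cinner x (v j)))\<^sup>2))) has_sum Re (cinner (frame_op x) x)) UNIV"
    by (rule has_sum_Re)
  then show ?thesis
    using has_sum_unique nrm2_has_sum[OF sqsum_coeff[of x]] by force
qed

text \<open>Functional calculus: the indeterminate stands for \<open>1 - frame_op\<close>, which also is a positive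
  contraction.\<close>

definition pop :: "real poly \<Rightarrow> 'h \<Rightarrow> 'h" where
  "pop p x = (\<Sum>i\<le>degree p. coeff p i *\<^sub>R ((\<lambda>y. y - frame_op y) ^^ i) x)"

lemma compl_frame_op_funpow_linear:
  "linear ((\<lambda>y. y - frame_op y) ^^ i)"
proof (induction i)
  case 0
  then show ?case by (simp add: linear_iff)
next
  case (Suc i)
  then show ?case
    by (auto simp: linear_iff frame_op_add frame_op_scaleR algebra_simps)
qed

lemma pop_add_right: "pop p (x + y) = pop p x + pop p y"
  using linear_add[OF compl_frame_op_funpow_linear]
  by (simp add: pop_def scaleR_add_right sum.distrib)

lemma pop_scaleR_right: "pop p (r *\<^sub>R x) = r *\<^sub>R pop p x"
  using linear_scale[OF compl_frame_op_funpow_linear]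
  by (simp add: pop_def scaleR_sum_right mult.commute)

lemma pop_zero [simp]: "pop 0 x = 0"
  by (simp add: pop_def)

lemma frame_op_zero [simp]: "frame_op 0 = 0"
  using frame_op_add[of 0 0] by simp

lemma frame_op_diff: "frame_op (x - y) = frame_op x - frame_op y"
  using frame_op_add[of "x - y" y] by simp

lemma frame_op_sum: "frame_op (sum f F) = (\<Sum>i\<in>F. frame_op (f i))"
  by (induction F rule: infinite_finite_induct) (auto simp: frame_op_add)

text \<open>One Horner step, with X acting as 1 - S; this recursion drives the inductions over
  polynomials.\<close>

lemma pop_pCons: "pop (pCons a p) x = a *\<^sub>R x + (pop p x - frame_op (pop p x))"
proof (cases "p = 0")
  case False
  then show ?thesis
    by (simp add: pop_def sum.atMost_Suc_shift frame_op_sum frame_op_scaleR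
        scaleR_diff_right sum_subtractf del: sum.atMost_Suc)
qed (simp add: pop_def)

lemma pop_add: "pop (p + q) x = pop p x + pop q x"
proof (induction p q rule: poly_induct2)
  case (pCons a p b q)
  then show ?case
    by (simp add: pop_pCons frame_op_add algebra_simps)
qed simp

lemma pop_smult: "pop (smult a p) x = a *\<^sub>R pop p x"
  by (induction p) (auto simp: pop_pCons frame_op_scaleR algebra_simps)

lemma pop_mult: "pop (p * q) x = pop p (pop q x)"
  by (induction p) (auto simp: pop_pCons pop_add pop_smult)

lemma pop_diff: "pop (p - q) x = pop p x - pop q x"
  using pop_add[of "p - q" q x] by simp

lemma pop_one [simp]: "pop 1 x = x"
  by (simp add: one_pCons pop_pCons)

lemma pop_spoly: "pop spoly x = frame_op x"
  using frame_op_diff[of 0 x] by (simp add: pop_pCons)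

lemma pop_zero_right [simp]: "pop p 0 = 0"
  using pop_add_right[of p 0 0] by simp

lemma pop_diff_right: "pop p (x - y) = pop p x - pop p y"
  using pop_add_right[of p "x - y" y] by simp

lemma pop_cscale: "pop p (cscale c x) = cscale c (pop p x)"
proof (induction p)
  case 0
  then show ?case
    using cscale_add_right[of c 0 0] by simp
next
  case (pCons a p)
  have "cscale c (y - z) = cscale c y - cscale c z" for y z :: 'h
    using cscale_add_right[of c "y - z" z] by simp
  then show ?case
    by (simp add: pop_pCons pCons cscale_add_right frame_op_cscale cscale_cscale mult.commute
        flip: cscale_of_real)
qed

text \<open>Applied to S itself for self-adjointness, and later to the unitaries of the
  representation.\<close>

lemma pop_commute:
  assumes add: "\<And>x y. U (x + y) = U x + U y" and scale: "\<And>r x. U (r *\<^sub>R x) = r *\<^sub>R U x"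
    and S: "\<And>x. frame_op (U x) = U (frame_op x)"
  shows "pop p (U x) = U (pop p x)"
proof (induction p)
  case 0
  then show ?case
    using scale[of 0 0] by simp
next
  case (pCons a p)
  have "U (y - z) = U y - U z" for y z
    using add[of "y - z" z] by simp
  then show ?case
    by (simp add: pop_pCons pCons add scale S)
qed

lemma pop_adjoint: "cinner (pop p x) y = cinner x (pop p y)"
  by (induction p arbitrary: x y)
    (auto simp: pop_pCons cinner_add_left cinner_add_right cinner_scaleR_left cinner_scaleR_right
      cinner_diff_left cinner_diff_right frame_op_adjoint
      pop_commute[of frame_op, OF frame_op_add frame_op_scaleR])

section \<open>Polynomials that give positive operators\<close>

text \<open>The operator inequality p <= q is written \<open>positive_poly (q - p)\<close>.\<close>

definition positive_poly :: "real poly \<Rightarrow> bool" where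
  "positive_poly p \<longleftrightarrow> (\<forall>x. Re (cinner (pop p x) x) \<ge> 0)"

lemma positive_poly_add: "positive_poly p \<Longrightarrow> positive_poly q \<Longrightarrow> positive_poly (p + q)"
  by (simp add: positive_poly_def pop_add cinner_add_left)

text \<open>As \<open>pop r\<close> is self-adjoint, one factor r moves across the inner product,
  and the form of p is evaluated at \<open>pop r x\<close>.\<close>

lemma positive_poly_square_mult: "positive_poly p \<Longrightarrow> positive_poly (r * r * p)"
  unfolding positive_poly_def
  by (metis mult.assoc mult.commute pop_adjoint pop_mult)

lemma positive_poly_const_mult: "a \<ge> 0 \<Longrightarrow> positive_poly p \<Longrightarrow> positive_poly ([:a:] * p)"
  by (simp add: positive_poly_def pop_smult cinner_scaleR_left)

lemma positive_spoly: "positive_poly spoly"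
  by (simp add: positive_poly_def pop_spoly Re_cinner_frame_op)

text \<open>The inequality 1 - S >= 0 is the Bessel bound.\<close>

lemma positive_X: "positive_poly [:0, 1:]"
  by (simp add: positive_poly_def pop_pCons cinner_diff_left Re_cinner_frame_op Re_cinner_self
      nrm2_coeff_le power_mono)

text \<open>With s for \<open>spoly\<close>, X + s = 1 gives s X = s X (X + s) = X^2 s + s^2 X, a
  sum of squares times positive factors. This replaces the square root argument for products of
  commuting positive operators.\<close>

lemma positive_spoly_X: "positive_poly (spoly * [:0, 1:])"
proof -
  have "spoly * [:0, 1:] = [:0, 1:] * [:0, 1:] * spoly + spoly * spoly * [:0, 1:]"
    by simp
  then show ?thesis
    using positive_poly_add positive_poly_square_mult positive_spoly positive_X by presburger
qed

text \<open>Factors X and s matter only modulo squares, by \<open>positive_poly_square_mult\<close>.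
  Hence the claims for the multiples of p by 1, X, s and s X together are stable under a Horner
  step, and the induction proves all four.\<close>

lemma nonneg_imp_positive:
  assumes "nonneg_poly p"
  shows "positive_poly p" "positive_poly (spoly * p)"
proof -
  have "positive_poly p \<and> positive_poly ([:0, 1:] * p) \<and> positive_poly (spoly * p) \<and>
      positive_poly (spoly * [:0, 1:] * p)"
    using assms
  proof (induction p)
    case 0
    then show ?case by (simp add: positive_poly_def)
  next
    case (pCons a p)
    let ?X = "[:0, 1:] :: real poly"
    have a: "a \<ge> 0" and "nonneg_poly p"
      using pCons.prems by (simp_all add: nonneg_poly_pCons_iff)
    then have IH: "positive_poly p" "positive_poly (?X * p)" "positive_poly (spoly * p)"
      "positive_poly (spoly * ?X * p)"
      using pCons.IH by auto
    have eq: "pCons a p = [:a:] * 1 + ?X * p"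
      by simp
    have one: "positive_poly 1"
      by (simp add: positive_poly_def Re_cinner_self)
    have "?X * pCons a p = [:a:] * ?X + ?X * ?X * p"
      "spoly * pCons a p = [:a:] * spoly + spoly * ?X * p"
      "spoly * ?X * pCons a p = [:a:] * (spoly * ?X) + ?X * ?X * (spoly * p)"
      unfolding eq by algebra+
    then show ?case
      using eq IH a positive_poly_add positive_poly_const_mult positive_poly_square_mult
        positive_spoly positive_X positive_spoly_X one by metis
  qed
  then show "positive_poly p" "positive_poly (spoly * p)"
    by auto
qed


section \<open>Estimates for the iterates and their defects\<close>

abbreviation (input) "approx n \<equiv> pop (newton n)"
abbreviation (input) "defect n \<equiv> pop (resid (newton n))"

lemma norm_pop_square: "(norm (pop p x))\<^sup>2 = Re (cinner (pop (p * p) x) x)"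
  by (simp add: pop_mult pop_adjoint flip: Re_cinner_self)

lemma pop_spoly_square: "pop (spoly * (p * p)) x = pop p (frame_op (pop p x))"
  by (metis mult.assoc mult.commute pop_mult pop_spoly)

lemma nrm2_pop_square:
  "(nrm2 (\<lambda>j. cinner (pop p x) (v j)))\<^sup>2 = Re (cinner (pop (spoly * (p * p)) x) x)"
  by (simp only: pop_spoly_square Re_cinner_frame_op[symmetric] pop_adjoint[of p "frame_op _"])

text \<open>The relation s p_n^2 = 1 - e_n turns the l2 norm into a quadratic form; the gap to the
  Parseval identity is the form of e_n.\<close>

lemma nrm2_approx_square:
  "(nrm2 (\<lambda>j. cinner (approx n x) (v j)))\<^sup>2 = (norm x)\<^sup>2 - Re (cinner (defect n x) x)"
  unfolding nrm2_pop_square spoly_newton by (simp add: pop_diff cinner_diff_left Re_cinner_self)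

lemma nrm2_approx_le: "nrm2 (\<lambda>j. cinner (approx n x) (v j)) \<le> norm x"
proof (rule power2_le_imp_le)
  show "(nrm2 (\<lambda>j. cinner (approx n x) (v j)))\<^sup>2 \<le> (norm x)\<^sup>2"
    using nonneg_imp_positive(1)[OF nonneg_resid_newton, of n]
    by (simp add: nrm2_approx_square positive_poly_def)
qed simp

lemma positive_poly_diff_le:
  "positive_poly (q - p) \<Longrightarrow> Re (cinner (pop p x) x) \<le> Re (cinner (pop q x) x)"
  by (simp add: positive_poly_def pop_diff cinner_diff_left)

text \<open>1 - e^2 = (1 - e) (1 + e) = s p^2 (1 + e) is s times a polynomial with nonnegative
  coefficients. The bound is uniform in n, which later carries convergence from the span to its
  closure.\<close>

lemma norm_defect_le: "norm (defect n x) \<le> norm x"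
proof -
  let ?e = "resid (newton n)"
  have "1 - ?e * ?e = (1 - ?e) * (1 + ?e)"
    by algebra
  also have "\<dots> = spoly * (newton n * newton n * (1 + ?e))"
    by (simp only: spoly_newton[symmetric] mult.assoc)
  finally have "positive_poly (1 - ?e * ?e)"
    by (simp only:) (intro nonneg_imp_positive(2) nonneg_poly_intros nonneg_newton nonneg_resid_newton)
  from positive_poly_diff_le[OF this, of x] have "(norm (pop ?e x))\<^sup>2 \<le> (norm x)\<^sup>2"
    by (simp add: norm_pop_square Re_cinner_self)
  then show ?thesis
    by (rule power2_le_imp_le) simp
qed

text \<open>The increments \<open>s\<^sub>n\<^sub>+\<^sub>1 - s\<^sub>n\<close> of \<open>s\<^sub>n = s p\<^sub>n\<^sup>2 \<le> 1\<close> dominate the decreasing sequence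
  \<open>s e\<^sub>n\<close>, so \<open>n s e\<^sub>n \<le> s\<^sub>n\<close>.\<close>

lemma positive_telescope:
  "positive_poly (1 - resid (newton n) - [:real n:] * (spoly * resid (newton n)))"
proof (induction n)
  case 0
  have "1 - resid (newton 0) - [:real 0:] * (spoly * resid (newton 0)) = spoly"
    by (simp add: resid_def)
  then show ?case
    by (simp only: positive_spoly)
next
  case (Suc n)
  define e p e' h where "e = resid (newton n)" and "p = newton n"
    and "e' = resid (newton (Suc n))" and "h = [:1/4::real:]"
  have e: "1 - e = spoly * (p * p)"
    by (simp only: e_def p_def spoly_newton)
  have h: "4 * h = 1" "[:3::real:] = 3"
    by (simp_all add: h_def numeral_poly)
  have e': "e' = h * (e * e * (3 + e))"
    unfolding e_def e'_def h_def resid_newton_Suc h(2) ..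
  have nn: "nonneg_poly e" "nonneg_poly p" "nonneg_poly h" "nonneg_poly (4::real poly)"
    by (simp_all add: e_def p_def h_def nonneg_resid_newton nonneg_newton nonneg_poly_pCons_iff
        nonneg_poly_0 numeral_poly)
  \<comment> \<open>From e' = e^2 (3 + e) / 4 one gets e - e' = e (4 + e) (1 - e) / 4, and 1 - e is
    then replaced by s p^2.\<close>
  have dec: "e - e' = spoly * (h * e * (4 + e) * (p * p))"
  proof -
    have "e - e' = h * e * (4 + e) * (1 - e)"
      unfolding e' using h(1) by algebra
    then show ?thesis
      unfolding e by (simp only: mult_ac)
  qed
  \<comment> \<open>By \<open>dec\<close> this is s^2 times a polynomial with nonnegative
    coefficients: s e_n decreases.\<close>
  have pos1: "positive_poly (spoly * (e - e'))"
    unfolding dec mult.assoc[symmetric, of spoly spoly]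
    by (intro positive_poly_square_mult nonneg_imp_positive(1) nonneg_poly_intros nn)
  \<comment> \<open>The increment e - e' dominates s e. Subtracting s e from \<open>dec\<close>
    leaves the factor p^2 - 1, whose coefficients are nonnegative because the iterates increase from
    1.\<close>
  have pos2: "positive_poly (e - e' - spoly * e)"
  proof -
    have "nonneg_poly (p - 1)"
      using nonneg_newton_diff[of 0 n] by (simp add: p_def)
    then have "nonneg_poly ((p - 1) * (p - 1) + (p - 1) + (p - 1))"
      by (intro nonneg_poly_intros)
    moreover have "(p - 1) * (p - 1) + (p - 1) + (p - 1) = p * p - 1"
      by algebra
    ultimately have "nonneg_poly (p * p - 1)"
      by simp
    then have "positive_poly (spoly * (h * e * e * (p * p) + e * (p * p - 1)))"
      by (intro nonneg_imp_positive(2) nonneg_poly_intros nn)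
    moreover have "e - e' - spoly * e = spoly * (h * e * e * (p * p) + e * (p * p - 1))"
      unfolding dec using h(1) by algebra
    ultimately show ?thesis
      by simp
  qed
  \<comment> \<open>The claim for n + 1 splits into the induction hypothesis, the newest increment
    minus s e, and n + 1 times the decrease of s e.\<close>
  have "1 - e' - [:real (Suc n):] * (spoly * e') =
      (1 - e - [:real n:] * (spoly * e)) + (e - e' - spoly * e)
      + [:real (Suc n):] * (spoly * (e - e'))"
  proof -
    have "[:real (Suc n):] = [:real n:] + 1"
      by (simp add: one_pCons)
    then show ?thesis
      by algebra
  qed
  moreover have "positive_poly (1 - e - [:real n:] * (spoly * e))"
    using Suc.IH unfolding e_def .
  ultimately show ?case
    unfolding e'_def[symmetric]
    by (simp only:) (intro positive_poly_add positive_poly_const_mult pos1 pos2 of_nat_0_le_iff)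
qed

text \<open>The left side is n times the form of s e_n^2 <= s e_n, and n s e_n <= 1 - e_n <= 1 by
  \<open>positive_telescope\<close>.\<close>

lemma nrm2_defect_le: "real n * (nrm2 (\<lambda>j. cinner (defect n x) (v j)))\<^sup>2 \<le> (norm x)\<^sup>2"
proof -
  let ?e = "resid (newton n)"
  \<comment> \<open>The difference s e (1 - e) equals s^2 e p^2, a square times nonnegative
    coefficients.\<close>
  have "spoly * ?e - spoly * (?e * ?e) = spoly * spoly * (?e * (newton n * newton n))"
    using spoly_newton[of n] by algebra
  then have "positive_poly (spoly * ?e - spoly * (?e * ?e))"
    by (simp only:)
      (intro positive_poly_square_mult nonneg_imp_positive(1) nonneg_poly_intros nonneg_newton
        nonneg_resid_newton)
  then have "(nrm2 (\<lambda>j. cinner (defect n x) (v j)))\<^sup>2 \<le> Re (cinner (pop (spoly * ?e) x) x)"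
    unfolding nrm2_pop_square by (rule positive_poly_diff_le)
  then have "real n * (nrm2 (\<lambda>j. cinner (defect n x) (v j)))\<^sup>2
      \<le> real n * Re (cinner (pop (spoly * ?e) x) x)"
    by (simp add: mult_left_mono)
  also have "\<dots> = Re (cinner (pop ([:real n:] * (spoly * ?e)) x) x)"
    by (simp only: pop_mult[of "[:real n:]"]) (simp add: pop_pCons cinner_scaleR_left)
  also have "\<dots> \<le> Re (cinner (pop (1 - ?e) x) x)"
    by (rule positive_poly_diff_le[OF positive_telescope])
  also have "\<dots> \<le> (norm x)\<^sup>2"
    using nonneg_imp_positive(1)[OF nonneg_resid_newton, of n]
    by (simp add: pop_diff cinner_diff_left positive_poly_def Re_cinner_self)
  finally show ?thesis .
qed

text \<open>The left side is the coefficient at j of \<open>pop p (pop p (v j))\<close>. Norms of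
  images of frame vectors are thus controlled by the analysis map, for which good bounds are
  known.\<close>

lemma norm_pop_frame_vector_le:
  "(norm (pop p (v j)))\<^sup>2 \<le> nrm2 (\<lambda>i. cinner (pop p (pop p (v j))) (v i))"
proof -
  have "(norm (pop p (v j)))\<^sup>2 = Re (cinner (pop p (pop p (v j))) (v j))"
    by (simp add: norm_pop_square pop_mult)
  also have "\<dots> \<le> cmod (cinner (pop p (pop p (v j))) (v j))"
    by (rule complex_Re_le_cmod)
  also have "\<dots> \<le> nrm2 (\<lambda>i. cinner (pop p (pop p (v j))) (v i))"
    by (rule cmod_le_nrm2[OF sqsum_coeff])
  finally show ?thesis .
qed

text \<open>With a the norm in question, \<open>norm_pop_frame_vector_le\<close> and
  \<open>nrm2_approx_le\<close> give a^2 <= a.\<close>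

lemma norm_approx_frame_vector_le: "norm (approx n (v j)) \<le> 1"
proof -
  have "(norm (approx n (v j)))\<^sup>2 \<le> norm (approx n (v j))"
    using norm_pop_frame_vector_le nrm2_approx_le order_trans by blast
  then show ?thesis
    by (cases "approx n (v j) = 0") (auto simp: power2_eq_square)
qed

text \<open>With a = \<open>norm (defect n (v j))\<close>, the coefficient bound and
  \<open>nrm2_defect_le\<close> at \<open>defect n (v j)\<close> give n a^4 <= a^2, so a^2 <=
  1/n.\<close>

lemma defect_frame_vector_tendsto: "(\<lambda>n. defect n (v j)) \<longlonglongrightarrow> 0"
proof -
  have le: "norm (defect n (v j)) \<le> sqrt (inverse (real n))" if "n > 0" for n
  proof -
    let ?a = "norm (defect n (v j))"
    have "real n * ((?a)\<^sup>2)\<^sup>2 \<le> real n * (nrm2 (\<lambda>i. cinner (defect n (defect n (v j))) (v i)))\<^sup>2"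
      by (intro mult_left_mono power_mono norm_pop_frame_vector_le) auto
    also have "\<dots> \<le> ?a\<^sup>2"
      by (rule nrm2_defect_le)
    finally have "real n * ?a\<^sup>2 * ?a\<^sup>2 \<le> 1 * ?a\<^sup>2"
      by (simp add: power2_eq_square mult_ac)
    then have "real n * ?a\<^sup>2 \<le> 1"
      by (cases "?a = 0") (auto simp del: norm_eq_zero simp: mult_le_cancel_right)
    then have "?a\<^sup>2 \<le> inverse (real n)"
      using that by (simp add: field_simps)
    then show ?thesis
      by (rule real_le_rsqrt)
  qed
  have "(\<lambda>n. sqrt (inverse (real n))) \<longlonglongrightarrow> 0"
    using tendsto_real_sqrt[OF lim_inverse_n[where 'a = real]] by (simp add: inverse_eq_divide)
  then show ?thesis
    by (rule Lim_null_comparison[rotated]) (rule eventually_mono[OF eventually_gt_at_top[of 0] le])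
qed

definition frame_space :: "'h set" where
  "frame_space = closure (cspan (range v))"

text \<open>Linearity handles the span; approximation and the uniform bound
  \<open>norm_defect_le\<close> handle the closure.\<close>

lemma defect_tendsto:
  assumes "x \<in> frame_space"
  shows "(\<lambda>n. defect n x) \<longlonglongrightarrow> 0"
proof -
  have span: "(\<lambda>n. defect n y) \<longlonglongrightarrow> 0" if "y \<in> cspan (range v)" for y
    using that
  proof (induction rule: module.span_induct_alt[OF module_cscale, consumes 1])
    case 1
    then show ?case by simp
  next
    case (2 c y z)
    then obtain j where "y = v j"
      by blast
    then have "(\<lambda>n. cscale c (defect n y) + defect n z) \<longlonglongrightarrow> cscale c 0 + 0"
      using 2 defect_frame_vector_tendsto
      by (intro tendsto_add bounded_linear.tendsto[OF bounded_linear_cscale]) auto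
    then show ?case
      by (simp add: pop_add_right pop_cscale linear_simps(3)[OF bounded_linear_cscale])
  qed
  show ?thesis
  proof (rule metric_LIMSEQ_I)
    fix e :: real
    assume "e > 0"
    then obtain y where y: "y \<in> cspan (range v)" "dist y x < e/2"
      using assms closure_approachable[of x] unfolding frame_space_def by (metis half_gt_zero)
    obtain N where N: "\<And>n. n \<ge> N \<Longrightarrow> dist (defect n y) 0 < e/2"
      using metric_LIMSEQ_D[OF span[OF y(1)], of "e/2"] \<open>e > 0\<close> by auto
    have "dist (defect n x) 0 < e" if "n \<ge> N" for n
    proof -
      have "defect n x = defect n (x - y) + defect n y"
        by (simp add: pop_diff_right)
      then have "norm (defect n x) \<le> norm (defect n (x - y)) + norm (defect n y)"
        by (metis norm_triangle_ineq)
      then show ?thesis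
        using norm_defect_le[of n "x - y"] y(2) N[OF that] by (simp add: dist_norm norm_minus_commute)
    qed
    then show "\<exists>N. \<forall>n\<ge>N. dist (defect n x) 0 < e"
      by blast
  qed
qed

section \<open>Cauchy estimates for the iterates\<close>

text \<open>The expression is 2 p_n (p_m - p_n).\<close>

lemma nonneg_newton_increment:
  assumes "n \<le> m"
  shows "nonneg_poly (newton m * newton m - newton n * newton n
    - (newton m - newton n) * (newton m - newton n))"
proof -
  have "newton m * newton m - newton n * newton n - (newton m - newton n) * (newton m - newton n)
      = [:2:] * (newton n * (newton m - newton n))"
    by (simp add: algebra_simps flip: numeral_poly)
  then show ?thesis
    using assms
    by (simp only:) (intro nonneg_poly_intros nonneg_newton nonneg_newton_diff, auto simp: nonneg_poly_0)
qed

lemma approx_increment_le: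
  assumes "n \<le> m"
  shows "(norm (approx m x - approx n x))\<^sup>2 \<le> (norm (approx m x))\<^sup>2 - (norm (approx n x))\<^sup>2"
proof -
  have "positive_poly (newton m * newton m - newton n * newton n
      - (newton m - newton n) * (newton m - newton n))"
    by (intro nonneg_imp_positive(1) nonneg_newton_increment assms)
  then show ?thesis
    unfolding pop_diff[symmetric] norm_pop_square positive_poly_def
    by (simp add: pop_diff[of _ "_ * _"] cinner_diff_left)
qed

text \<open>\<open>nonneg_newton_increment\<close> multiplied by s, which produces the forms that
  compute \<open>nrm2\<close>.\<close>

lemma nrm2_approx_increment_le:
  assumes "n \<le> m"
  shows "(nrm2 (\<lambda>j. cinner (approx m x - approx n x) (v j)))\<^sup>2
    \<le> (nrm2 (\<lambda>j. cinner (approx m x) (v j)))\<^sup>2 - (nrm2 (\<lambda>j. cinner (approx n x) (v j)))\<^sup>2"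
proof -
  let ?a = "newton m * newton m" and ?b = "newton n * newton n"
    and ?c = "(newton m - newton n) * (newton m - newton n)"
  have "spoly * (?a - ?b - ?c) = spoly * ?a - spoly * ?b - spoly * ?c"
    by algebra
  then have "positive_poly (spoly * ?a - spoly * ?b - spoly * ?c)"
    using nonneg_imp_positive(2)[OF nonneg_newton_increment[OF assms]] by metis
  then have "0 \<le> Re (cinner (pop (spoly * ?a) x) x) - Re (cinner (pop (spoly * ?b) x) x)
      - Re (cinner (pop (spoly * ?c) x) x)"
    unfolding positive_poly_def pop_diff[of _ "spoly * _"] cinner_diff_left by simp
  then show ?thesis
    unfolding pop_diff[symmetric] nrm2_pop_square by linarith
qed


section \<open>The limiting Parseval frame\<close>

text \<open>The vector S^(-1/2) \<open>v j\<close>; the next lemma shows that the limit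
  exists.\<close>

definition w :: "'i \<Rightarrow> 'h" where
  "w j = lim (\<lambda>n. approx n (v j))"

lemma approx_frame_vector_tendsto: "(\<lambda>n. approx n (v j)) \<longlonglongrightarrow> w j"
proof -
  have "convergent (\<lambda>n. approx n (v j))"
  proof (rule increments_bounded_imp_convergent)
    show "(norm (approx m (v j) - approx n (v j)))\<^sup>2 \<le>
        (norm (approx m (v j)))\<^sup>2 - (norm (approx n (v j)))\<^sup>2" if "n \<le> m" for m n
      using that by (rule approx_increment_le)
    show "(norm (approx n (v j)))\<^sup>2 \<le> 1" for n
      using norm_approx_frame_vector_le by (simp add: power_le_one)
  qed
  then show ?thesis
    by (simp add: w_def convergent_LIMSEQ_iff)
qed

lemma closed_frame_space: "closed frame_space"
  by (simp add: frame_space_def)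

lemma frame_vector_in_frame_space: "v j \<in> frame_space"
  unfolding frame_space_def by (rule subsetD[OF closure_subset module.span_base[OF module_cscale]]) simp

lemma frame_space_zero: "0 \<in> frame_space"
  unfolding frame_space_def by (rule subsetD[OF closure_subset module.span_zero[OF module_cscale]])

lemma frame_space_add:
  assumes "x \<in> frame_space" "y \<in> frame_space"
  shows "x + y \<in> frame_space"
proof -
  obtain a b where "\<And>n. a n \<in> cspan (range v)" "a \<longlonglongrightarrow> x" "\<And>n. b n \<in> cspan (range v)" "b \<longlonglongrightarrow> y"
    using assms unfolding frame_space_def closure_sequential by blast
  then show ?thesis
    unfolding frame_space_def closure_sequential
    by (intro exI[of _ "\<lambda>n. a n + b n"]) (auto intro: tendsto_add module.span_add[OF module_cscale])
qed

lemma frame_space_cscale: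
  assumes "x \<in> frame_space"
  shows "cscale c x \<in> frame_space"
proof -
  obtain a where "\<And>n. a n \<in> cspan (range v)" "a \<longlonglongrightarrow> x"
    using assms unfolding frame_space_def closure_sequential by blast
  then show ?thesis
    unfolding frame_space_def closure_sequential
    by (intro exI[of _ "\<lambda>n. cscale c (a n)"])
      (auto intro: bounded_linear.tendsto[OF bounded_linear_cscale] module.span_scale[OF module_cscale])
qed

lemma frame_space_scaleR: "x \<in> frame_space \<Longrightarrow> r *\<^sub>R x \<in> frame_space"
  by (metis frame_space_cscale cscale_of_real)

lemma frame_space_diff: "x \<in> frame_space \<Longrightarrow> y \<in> frame_space \<Longrightarrow> x - y \<in> frame_space"
  using frame_space_add[of x "(-1) *\<^sub>R y"] frame_space_scaleR[of y "-1"] by simp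

lemma frame_op_in_frame_space: "frame_op x \<in> frame_space"
proof (rule Lim_in_closed_set[OF closed_frame_space])
  show "(sum (\<lambda>j. cscale (cinner x (v j)) (v j)) \<longlongrightarrow> frame_op x) (finite_subsets_at_top UNIV)"
    using has_sum_frame_op by (simp add: has_sum_def)
  have "(\<Sum>j\<in>F. cscale (cinner x (v j)) (v j)) \<in> frame_space" for F
    by (induction F rule: infinite_finite_induct)
      (auto simp: frame_space_zero intro: frame_space_add frame_space_cscale frame_vector_in_frame_space)
  then show "\<forall>\<^sub>F F in finite_subsets_at_top UNIV. (\<Sum>j\<in>F. cscale (cinner x (v j)) (v j)) \<in> frame_space"
    by simp
qed simp

lemma pop_in_frame_space: "x \<in> frame_space \<Longrightarrow> pop p x \<in> frame_space"
  by (induction p) (auto simp: pop_pCons frame_space_zero intro!: frame_space_add frame_space_diff frame_space_scaleR frame_op_in_frame_space)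

lemma w_in_frame_space: "w j \<in> frame_space"
  using closed_sequentially[OF closed_frame_space _ approx_frame_vector_tendsto] pop_in_frame_space frame_vector_in_frame_space
  by blast

text \<open>By self-adjointness, \<open>cinner x (w j)\<close> is the limit of
  \<open>cinner (approx m x) (v j)\<close>. On finite index sets m may tend to infinity in the
  Cauchy estimate, and the resulting bound passes to all indices.\<close>

lemma analysis_w_approx:
  assumes "e > 0"
  shows "\<exists>N. \<forall>n\<ge>N. sqsum (\<lambda>j. cinner x (w j) - cinner (approx n x) (v j)) \<and>
    nrm2 (\<lambda>j. cinner x (w j) - cinner (approx n x) (v j)) \<le> e"
proof -
  obtain N where N: "\<forall>n\<ge>N. \<forall>m\<ge>n. (nrm2 (\<lambda>j. cinner (approx m x - approx n x) (v j)))\<^sup>2 < e\<^sup>2"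
    using increments_bounded_imp_small[
        of "\<lambda>m n. (nrm2 (\<lambda>j. cinner (approx m x - approx n x) (v j)))\<^sup>2"
          "\<lambda>n. (nrm2 (\<lambda>j. cinner (approx n x) (v j)))\<^sup>2" "(norm x)\<^sup>2" "e\<^sup>2"]
      nrm2_approx_increment_le[of _ _ x] power_mono[OF nrm2_approx_le[of _ x] nrm2_nonneg] assms
    by auto
  have "L2_set (\<lambda>j. cmod (cinner x (w j) - cinner (approx n x) (v j))) F \<le> e" if "n \<ge> N" for n F
  proof (rule LIMSEQ_le_const2)
    show "(\<lambda>m. L2_set (\<lambda>j. cmod (cinner (approx m x - approx n x) (v j))) F)
        \<longlonglongrightarrow> L2_set (\<lambda>j. cmod (cinner x (w j) - cinner (approx n x) (v j))) F"
      unfolding L2_set_def cinner_diff_left pop_adjoint[of "newton m" for m]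
      by (intro tendsto_intros tendsto_cinner approx_frame_vector_tendsto)
    have "L2_set (\<lambda>j. cmod (cinner (approx m x - approx n x) (v j))) F \<le> e" if "m \<ge> n" for m
    proof -
      have "(nrm2 (\<lambda>j. cinner (approx m x - approx n x) (v j)))\<^sup>2 < e\<^sup>2"
        using N that \<open>n \<ge> N\<close> by blast
      then have "nrm2 (\<lambda>j. cinner (approx m x - approx n x) (v j)) < e"
        using assms by (auto intro: power2_less_imp_less)
      then show ?thesis
        using L2_set_le_nrm2[OF sqsum_coeff[of "approx m x - approx n x"], of F] by linarith
    qed
    then show "\<exists>N. \<forall>m\<ge>N. L2_set (\<lambda>j. cmod (cinner (approx m x - approx n x) (v j))) F \<le> e"
      by blast
  qed
  then show ?thesis
    by (intro exI[of _ N] allI impI conjI L2_set_bound_imp)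
qed

lemma sqsum_w: "sqsum (\<lambda>j. cinner x (w j))"
proof -
  obtain n where n: "sqsum (\<lambda>j. cinner x (w j) - cinner (approx n x) (v j))"
    using analysis_w_approx[of 1 x] by auto
  have "sqsum (\<lambda>j. - cinner (approx n x) (v j))"
    using sqsum_coeff by (simp add: sqsum_def)
  from sqsum_diff[OF n this] show ?thesis
    by simp
qed

text \<open>Pass to the limit in \<open>nrm2_approx_square\<close>; the defect term vanishes on
  \<open>frame_space\<close>.\<close>

lemma nrm2_w:
  assumes "x \<in> frame_space"
  shows "nrm2 (\<lambda>j. cinner x (w j)) = norm x"
proof -
  let ?a = "\<lambda>n. nrm2 (\<lambda>j. cinner (approx n x) (v j))"
  have "?a \<longlonglongrightarrow> nrm2 (\<lambda>j. cinner x (w j))"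
  proof (rule metric_LIMSEQ_I)
    fix e :: real
    assume "e > 0"
    then obtain N where N: "\<And>n. n \<ge> N \<Longrightarrow> nrm2 (\<lambda>j. cinner x (w j) - cinner (approx n x) (v j)) \<le> e/2"
      using analysis_w_approx[of "e/2" x] by auto
    have "dist (?a n) (nrm2 (\<lambda>j. cinner x (w j))) < e" if "n \<ge> N" for n
      using nrm2_le_diff[OF sqsum_w[of x] sqsum_coeff[of "approx n x"]] N[OF that] \<open>e > 0\<close>
      by (simp add: dist_real_def abs_minus_commute)
    then show "\<exists>N. \<forall>n\<ge>N. dist (?a n) (nrm2 (\<lambda>j. cinner x (w j))) < e"
      by blast
  qed
  then have "(\<lambda>n. (?a n)\<^sup>2) \<longlonglongrightarrow> (nrm2 (\<lambda>j. cinner x (w j)))\<^sup>2"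
    by (rule tendsto_power)
  moreover have "(\<lambda>n. (?a n)\<^sup>2) \<longlonglongrightarrow> (norm x)\<^sup>2 - Re (cinner 0 x)"
    unfolding nrm2_approx_square by (intro tendsto_intros tendsto_cinner defect_tendsto assms)
  ultimately have "(nrm2 (\<lambda>j. cinner x (w j)))\<^sup>2 = (norm x)\<^sup>2"
    using LIMSEQ_unique by fastforce
  then show ?thesis
    by (simp add: power2_eq_iff_nonneg)
qed

section \<open>Range of the limiting analysis map\<close>

text \<open>S - S^2 = S (1 - S) >= 0, and the form of S is the square of the right side.\<close>

lemma norm_frame_op_le: "norm (frame_op x) \<le> nrm2 (\<lambda>j. cinner x (v j))"
proof (rule power2_le_imp_le)
  have "spoly - spoly * spoly = spoly * [:0, 1:]"
    by simp
  then have "positive_poly (spoly - spoly * spoly)"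
    by (simp only: positive_spoly_X)
  from positive_poly_diff_le[OF this, of x]
  show "(norm (frame_op x))\<^sup>2 \<le> (nrm2 (\<lambda>j. cinner x (v j)))\<^sup>2"
    by (simp only: norm_pop_square[symmetric] pop_spoly Re_cinner_frame_op)
qed simp

text \<open>The witness is the limit of \<open>frame_op (approx n y)\<close>, that is, the square root of the frame
  operator applied to \<open>y\<close>.\<close>

lemma analysis_in_range_w: "\<exists>z\<in>frame_space. \<forall>j. cinner z (w j) = cinner y (v j)"
proof -
  let ?b = "\<lambda>n. (nrm2 (\<lambda>j. cinner (approx n y) (v j)))\<^sup>2"
  have "convergent (\<lambda>n. frame_op (approx n y))"
  proof (rule increments_bounded_imp_convergent)
    show "(norm (frame_op (approx m y) - frame_op (approx n y)))\<^sup>2 \<le> ?b m - ?b n"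
      if "n \<le> m" for m n
      unfolding frame_op_diff[symmetric]
      by (rule order_trans[OF power_mono[OF norm_frame_op_le] nrm2_approx_increment_le])
        (use that in auto)
    show "?b n \<le> (norm y)\<^sup>2" for n
      by (intro power_mono nrm2_approx_le nrm2_nonneg)
  qed
  then obtain z where z: "(\<lambda>n. frame_op (approx n y)) \<longlonglongrightarrow> z"
    by (auto simp: convergent_def)
  have "z \<in> frame_space"
    using closed_sequentially[OF closed_frame_space _ z] frame_op_in_frame_space by blast
  moreover have "cinner z (w j) = cinner y (v j)" for j
  proof -
    \<comment> \<open>Moving all operators to the right argument gives S p_n^2 = 1 - e_n acting on
      \<open>v j\<close>.\<close>
    have "cinner (frame_op (approx n y)) (approx n (v j)) = cinner y (v j) - cinner y (defect n (v j))"
      for n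
    proof -
      have "cinner (frame_op (approx n y)) (approx n (v j))
          = cinner y (pop (spoly * (newton n * newton n)) (v j))"
        by (simp only: pop_spoly_square pop_adjoint[of _ y] frame_op_adjoint)
      then show ?thesis
        by (simp only: spoly_newton pop_diff pop_one cinner_diff_right)
    qed
    moreover have "(\<lambda>n. cinner y (v j) - cinner y (defect n (v j))) \<longlonglongrightarrow> cinner y (v j) - cinner y 0"
      by (intro tendsto_intros tendsto_cinner defect_frame_vector_tendsto)
    moreover have "(\<lambda>n. cinner (frame_op (approx n y)) (approx n (v j))) \<longlonglongrightarrow> cinner z (w j)"
      by (intro tendsto_cinner z approx_frame_vector_tendsto)
    ultimately show ?thesis
      using LIMSEQ_unique by fastforce
  qed
  ultimately show ?thesis
    by blast
qed

text \<open>Every analysis value of \<open>v\<close> is one of \<open>w\<close> at some point of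
  \<open>frame_space\<close>, where the analysis map of \<open>w\<close> is isometric. Approximants
  of f thus give a Cauchy sequence in H, and its limit represents f coefficientwise.\<close>

lemma analysis_closure_in_range_w:
  assumes f: "sqsum f"
    and dense: "\<And>e. e > 0 \<Longrightarrow> \<exists>y. nrm2 (\<lambda>j. f j - cinner y (v j)) < e"
  shows "\<exists>z. \<forall>j. f j = cinner z (w j)"
proof -
  have "\<exists>z\<in>frame_space. nrm2 (\<lambda>j. f j - cinner z (w j)) < e" if "e > 0" for e
  proof -
    obtain y where y: "nrm2 (\<lambda>j. f j - cinner y (v j)) < e"
      using dense[OF \<open>e > 0\<close>] by blast
    obtain z where "z \<in> frame_space" "\<And>j. cinner z (w j) = cinner y (v j)"
      using analysis_in_range_w by blast
    with y show ?thesis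
      by (intro bexI[of _ z]) simp_all
  qed
  then have "\<exists>z. \<forall>n::nat. z n \<in> frame_space \<and> nrm2 (\<lambda>j. f j - cinner (z n) (w j)) < inverse (real (Suc n))"
    by (intro choice allI) (meson inverse_positive_iff_positive of_nat_0_less_iff zero_less_Suc)
  then obtain z where zM: "\<And>n. z n \<in> frame_space"
    and z: "\<And>n. nrm2 (\<lambda>j. f j - cinner (z n) (w j)) < inverse (real (Suc n))"
    by blast
  have sq: "sqsum (\<lambda>j. f j - cinner (z n) (w j))" for n
    by (intro sqsum_diff f sqsum_w)
  have small: "\<exists>N. \<forall>n\<ge>N. nrm2 (\<lambda>j. f j - cinner (z n) (w j)) < e" if "e > 0" for e
  proof -
    obtain N where N: "inverse (real (Suc N)) < e"
      using reals_Archimedean \<open>e > 0\<close> by blast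
    have "nrm2 (\<lambda>j. f j - cinner (z n) (w j)) < e" if "n \<ge> N" for n
    proof -
      have "inverse (real (Suc n)) \<le> inverse (real (Suc N))"
        using that by (simp add: field_simps)
      then show ?thesis
        using z[of n] N by linarith
    qed
    then show ?thesis
      by blast
  qed
  have dist: "norm (z m - z n)
      \<le> nrm2 (\<lambda>j. f j - cinner (z n) (w j)) + nrm2 (\<lambda>j. f j - cinner (z m) (w j))" for m n
  proof -
    have "norm (z m - z n) = nrm2 (\<lambda>j. cinner (z m - z n) (w j))"
      by (simp add: nrm2_w frame_space_diff zM)
    also have "\<dots> = nrm2 (\<lambda>j. (f j - cinner (z n) (w j)) - (f j - cinner (z m) (w j)))"
      by (simp add: cinner_diff_left)
    also have "\<dots> \<le> nrm2 (\<lambda>j. f j - cinner (z n) (w j)) + nrm2 (\<lambda>j. f j - cinner (z m) (w j))"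
      by (intro nrm2_diff_le sq)
    finally show ?thesis .
  qed
  have "Cauchy z"
  proof (rule metric_CauchyI)
    fix e :: real
    assume "e > 0"
    then obtain N where N: "\<And>n. n \<ge> N \<Longrightarrow> nrm2 (\<lambda>j. f j - cinner (z n) (w j)) < e/2"
      using small[of "e/2"] by auto
    have "dist (z m) (z n) < e" if "m \<ge> N" "n \<ge> N" for m n
      using dist[of m n] N[OF that(1)] N[OF that(2)] by (simp add: dist_norm)
    then show "\<exists>N. \<forall>m\<ge>N. \<forall>n\<ge>N. dist (z m) (z n) < e"
      by blast
  qed
  then obtain l where l: "z \<longlonglongrightarrow> l"
    using Cauchy_convergent convergent_def by blast
  have "f j = cinner l (w j)" for j
  proof (rule LIMSEQ_unique[of "\<lambda>n. cinner (z n) (w j)"])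
    show "(\<lambda>n. cinner (z n) (w j)) \<longlonglongrightarrow> cinner l (w j)"
      by (intro tendsto_cinner l tendsto_const)
    show "(\<lambda>n. cinner (z n) (w j)) \<longlonglongrightarrow> f j"
    proof (rule metric_LIMSEQ_I)
      fix e :: real
      assume "e > 0"
      then obtain N where N: "\<And>n. n \<ge> N \<Longrightarrow> nrm2 (\<lambda>j. f j - cinner (z n) (w j)) < e"
        using small by blast
      have "dist (cinner (z n) (w j)) (f j) < e" if "n \<ge> N" for n
        using cmod_le_nrm2[OF sq[of n], of j] N[OF that] by (simp add: dist_norm norm_minus_commute)
      then show "\<exists>N. \<forall>n\<ge>N. dist (cinner (z n) (w j)) (f j) < e"
        by blast
    qed
  qed
  then show ?thesis
    by blast
qed


section \<open>Symmetries of the frame operator\<close>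

text \<open>U permutes the frame vectors up to unimodular factors, which cancel in each rank-one
  term of S. Pairing with y = U y' leaves a reindexing of the series by
  \<open>\<phi>\<close>.\<close>

lemma frame_op_commute:
  assumes U: "unitary U" and "bij \<phi>"
    and v: "\<And>j. v (\<phi> j) = cscale (m j) (U (v j))" "\<And>j. cmod (m j) = 1"
  shows "frame_op (U x) = U (frame_op x)"
proof (rule chilbert_eqI)
  fix y
  obtain y' where y: "y = U y'"
    using U unfolding unitary_def by (metis surjD)
  have inner: "cinner (U a) (U b) = cinner a b" for a b
    using U by (simp add: unitary_def)
  have "cinner (U x) (v (\<phi> j)) * cinner (v (\<phi> j)) y = cinner x (v j) * cinner (v j) y'" for j
  proof -
    have "m j * cnj (m j) = 1"
      using v(2)[of j] complex_norm_square[of "m j"] by simp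
    then show ?thesis
      by (simp add: v(1) y cinner_cscale_left cinner_cscale_right inner mult_ac)
  qed
  then have "((\<lambda>j. cinner (U x) (v (\<phi> j)) * cinner (v (\<phi> j)) y) has_sum cinner (frame_op x) y') UNIV"
    using has_sum_cinner_frame_op[of x y'] by simp
  then have "((\<lambda>j. cinner (U x) (v j) * cinner (v j) y) has_sum cinner (frame_op x) y') UNIV"
    by (rule has_sum_reindex_bij_betw[OF \<open>bij \<phi>\<close>, THEN iffD1])
  then show "cinner (frame_op (U x)) y = cinner (U (frame_op x)) y"
    using has_sum_unique[OF has_sum_cinner_frame_op] by (simp add: y inner)
qed

end

section \<open>Orbits of projective representations\<close>

lemma unitary_norm: "unitary U \<Longrightarrow> norm (U x) = norm x"
  by (simp add: unitary_def norm_cinner)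

lemma
  assumes "unitary U"
  shows unitary_add: "U (x + y) = U x + U y"
    and unitary_cscale: "U (cscale c x) = cscale c (U x)"
    and unitary_scaleR: "U (r *\<^sub>R x) = r *\<^sub>R U x"
    and unitary_diff: "U (x - y) = U x - U y"
proof -
  show add: "U (x + y) = U x + U y" for x y
    using assms by (simp add: unitary_def clinear_def)
  show "U (cscale c x) = cscale c (U x)" for c x
    using assms by (simp add: unitary_def clinear_def)
  then show "U (r *\<^sub>R x) = r *\<^sub>R U x"
    by (metis cscale_of_real)
  show "U (x - y) = U x - U y"
    using add[of "x - y" y] by simp
qed

lemma module_fscale: "module fscale"
  by unfold_locales (auto simp: fscale_def algebra_simps fun_eq_iff)

text \<open>\<open>Theta\<close> is linear in its vector argument, so its range is a subspace and
  \<open>closed_span_l2\<close> of it is its l2 closure.\<close>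

lemma span_range_Theta: "module.span fscale (range (Theta k \<xi> \<pi>)) = range (Theta k \<xi> \<pi>)"
proof -
  have "module.subspace fscale (range (Theta k \<xi> \<pi>))"
    unfolding module.subspace_def[OF module_fscale]
  proof (intro conjI ballI allI)
    have "Theta k \<xi> \<pi> 0 = 0"
      by (simp add: Theta_def fun_eq_iff)
    then show "0 \<in> range (Theta k \<xi> \<pi>)"
      by (metis rangeI)
  next
    fix f g
    assume "f \<in> range (Theta k \<xi> \<pi>)" "g \<in> range (Theta k \<xi> \<pi>)"
    then obtain x y where "f = Theta k \<xi> \<pi> x" "g = Theta k \<xi> \<pi> y"
      by blast
    then have "f + g = Theta k \<xi> \<pi> (x + y)"
      by (auto simp: Theta_def fun_eq_iff cinner_add_left)
    then show "f + g \<in> range (Theta k \<xi> \<pi>)"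
      by simp
  next
    fix c f
    assume "f \<in> range (Theta k \<xi> \<pi>)"
    then obtain x where "f = Theta k \<xi> \<pi> x"
      by blast
    then have "fscale c f = Theta k \<xi> \<pi> (cscale c x)"
      by (auto simp: Theta_def fscale_def fun_eq_iff cinner_cscale_left)
    then show "fscale c f \<in> range (Theta k \<xi> \<pi>)"
      by simp
  qed
  then show ?thesis
    by (simp add: module.span_eq_iff[OF module_fscale])
qed

theorem lemma3p4:
  fixes \<pi> :: "'g::{group_add, countable} \<Rightarrow> 'h::chilbert \<Rightarrow> 'h"
    and \<mu> :: "'g \<Rightarrow> 'g \<Rightarrow> complex"
    and \<xi> :: "nat \<Rightarrow> 'h"
    and k :: nat
  assumes rep: "proj_unitary_rep \<pi> \<mu>"
    and bes: "bessel (\<lambda>(i, g). \<pi> g (\<xi> i)) ({1..k} \<times> UNIV)"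
    and M_def: "M = closure (cspan (\<Union>i\<in>{1..k}. range (\<lambda>g. \<pi> g (\<xi> i))))"
  shows "\<exists>\<eta> :: nat \<Rightarrow> 'h.
           parseval_frame_for (\<lambda>(i, g). \<pi> g (\<eta> i)) ({1..k} \<times> UNIV) M \<and>
           range (Theta k \<eta> \<pi>) = closed_span_l2 k (range (Theta k \<xi> \<pi>))"
proof -
  have un: "unitary (\<pi> g)" and mu: "cmod (\<mu> g h) = 1"
    and pi: "\<pi> g (\<pi> h x) = cscale (\<mu> g h) (\<pi> (g + h) x)" for g h x
    using rep by (auto simp: proj_unitary_rep_def)
  note linear = un[THEN unitary_add] un[THEN unitary_cscale] un[THEN unitary_scaleR]
    un[THEN unitary_diff]

  obtain B where B: "\<And>x. (\<lambda>j. (cmod (cinner x (case j of (i, g) \<Rightarrow> \<pi> g (\<xi> i))))\<^sup>2) summable_on {1..k} \<times> UNIV"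
    "\<And>x. (\<Sum>\<^sub>\<infinity>j\<in>{1..k} \<times> UNIV. (cmod (cinner x (case j of (i, g) \<Rightarrow> \<pi> g (\<xi> i))))\<^sup>2) \<le> B * (norm x)\<^sup>2"
    using bes unfolding bessel_def by blast
  \<comment> \<open>The scaling brings the Bessel bound down to 1; \<open>max 1 B\<close> keeps the
    root positive even if B is not.\<close>
  define c where "c = 1 / sqrt (max 1 B)"
  have c: "c > 0" "c\<^sup>2 * B \<le> 1"
    by (auto simp: c_def power_divide field_simps max_def)

  \<comment> \<open>Zero vectors at indices outside \<open>{1..k}\<close> let the family run over a
    whole type; they change neither the square sums nor the span.\<close>
  define v where "v = (\<lambda>(i, g). if i \<in> {1..k} then c *\<^sub>R \<pi> g (\<xi> i) else 0)"
  have vin: "v (i, g) = c *\<^sub>R \<pi> g (\<xi> i)" if "i \<in> {1..k}" for i g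
    using that by (simp add: v_def)
  have vout: "v (i, g) = 0" if "i \<notin> {1..k}" for i g
    unfolding v_def using that by (simp only: prod.case if_False)

  interpret unit_bessel v
  proof
    fix x
    let ?q = "\<lambda>j. (cmod (cinner x (case j of (i, g) \<Rightarrow> \<pi> g (\<xi> i))))\<^sup>2"
    let ?t = "infsum ?q ({1..k} \<times> UNIV)"
    have "((\<lambda>j. c\<^sup>2 * ?q j) has_sum c\<^sup>2 * ?t) ({1..k} \<times> UNIV)"
      using B(1) by (intro has_sum_cmult_right has_sum_infsum)
    also have "?this \<longleftrightarrow> ((\<lambda>j. (cmod (cinner x (v j)))\<^sup>2) has_sum c\<^sup>2 * ?t) UNIV"
    proof (rule has_sum_cong_neutral)
      show "(cmod (cinner x (v j)))\<^sup>2 = 0" if "j \<in> UNIV - {1..k} \<times> UNIV" for j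
        using that vout by (cases j) auto
      show "c\<^sup>2 * ?q j = (cmod (cinner x (v j)))\<^sup>2" if "j \<in> {1..k} \<times> UNIV \<inter> UNIV" for j
        using that vin c(1)
        by (cases j) (auto simp: cinner_scaleR_right norm_mult power_mult_distrib)
    qed auto
    finally have q: "((\<lambda>j. (cmod (cinner x (v j)))\<^sup>2) has_sum c\<^sup>2 * ?t) UNIV" .
    then show "sqsum (\<lambda>j. cinner x (v j))"
      unfolding sqsum_def using summable_on_def by blast
    have "c\<^sup>2 * ?t \<le> c\<^sup>2 * (B * (norm x)\<^sup>2)"
      using B(2) by (intro mult_left_mono) auto
    also have "\<dots> \<le> (norm x)\<^sup>2"
      using mult_right_mono[OF c(2), of "(norm x)\<^sup>2"] by (simp add: mult_ac)
    finally show "nrm2 (\<lambda>j. cinner x (v j)) \<le> norm x"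
      unfolding nrm2_def infsumI[OF q] by (intro real_le_lsqrt) auto
  qed

  have M: "M = frame_space"
  proof -
    have "range v \<subseteq> cspan (\<Union>i\<in>{1..k}. range (\<lambda>g. \<pi> g (\<xi> i)))"
    proof clarify
      fix i g
      show "v (i, g) \<in> cspan (\<Union>i\<in>{1..k}. range (\<lambda>g. \<pi> g (\<xi> i)))"
      proof (cases "i \<in> {1..k}")
        case True
        show ?thesis
          unfolding vin[OF True] cscale_of_real[symmetric]
          by (intro module.span_scale[OF module_cscale] module.span_base[OF module_cscale]
              UN_I[OF True] rangeI)
      qed (simp add: vout module.span_zero[OF module_cscale])
    qed
    moreover have "\<pi> g (\<xi> i) \<in> cspan (range v)" if "i \<in> {1..k}" for i g
    proof -
      have "\<pi> g (\<xi> i) = cscale (of_real (1 / c)) (v (i, g))"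
        unfolding cscale_of_real using c that by (simp add: vin)
      then show ?thesis
        by (simp only: module.span_scale[OF module_cscale module.span_base[OF module_cscale]] rangeI)
    qed
    ultimately have "cspan (\<Union>i\<in>{1..k}. range (\<lambda>g. \<pi> g (\<xi> i))) = cspan (range v)"
      by (subst module.span_eq[OF module_cscale]) auto
    then show ?thesis
      by (simp add: M_def frame_space_def)
  qed

  \<comment> \<open>Left translation by h permutes the orbits: \<open>\<pi> (h + g)\<close> is
    \<open>\<pi> h\<close> after \<open>\<pi> g\<close>, up to the unimodular factor
    \<open>inverse (\<mu> h g)\<close>.\<close>
  have "frame_op (\<pi> h x) = \<pi> h (frame_op x)" for h x
  proof (rule frame_op_commute[OF un, where \<phi> = "\<lambda>(i, g). (i, h + g)" and m = "\<lambda>(i, g). inverse (\<mu> h g)"])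
    show "bij (\<lambda>(i::nat, g). (i, h + g))"
      by (rule bij_betw_byWitness[where f' = "\<lambda>(i, g). (i, - h + g)"])
        (auto simp flip: add.assoc)
    fix j :: "nat \<times> 'g"
    show "cmod (case j of (i, g) \<Rightarrow> inverse (\<mu> h g)) = 1"
      using mu by (auto simp: norm_inverse split: prod.split)
    obtain i g where j: "j = (i, g)"
      by fastforce
    have "\<mu> h g \<noteq> 0"
      using mu[of h g] by auto
    then have "\<pi> (h + g) (\<xi> i) = cscale (inverse (\<mu> h g)) (\<pi> h (\<pi> g (\<xi> i)))"
      by (simp add: pi cscale_cscale)
    moreover have "cscale a (r *\<^sub>R y) = r *\<^sub>R cscale a y" for a r and y :: 'h
      by (simp add: cscale_cscale mult.commute flip: cscale_of_real)
    moreover have "\<pi> h 0 = 0"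
      using linear(3)[of h 0 0] by simp
    moreover have "cscale a 0 = (0::'h)" for a
      using norm_cscale[of a "0::'h"] by simp
    ultimately show "v (case j of (i, g) \<Rightarrow> (i, h + g))
        = cscale (case j of (i, g) \<Rightarrow> inverse (\<mu> h g)) (\<pi> h (v j))"
      by (cases "i \<in> {1..k}") (simp_all only: j prod.case vin vout linear not_False_eq_True)
  qed
  then have pop_pi: "pop p (\<pi> h x) = \<pi> h (pop p x)" for p h x
    by (intro pop_commute linear)

  \<comment> \<open>In a projective representation \<open>\<pi> 0\<close> is only a unimodular
    multiple of the identity, so the generator is the preimage of the limit at the group
    identity.\<close>
  define \<eta> where "\<eta> i = inv (\<pi> 0) (w (i, 0))" for i
  have \<eta>: "w (i, 0) = \<pi> 0 (\<eta> i)" for i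
    using un[of 0] by (simp add: \<eta>_def unitary_def surj_f_inv_f)
  have wout: "w (i, g) = 0" if "i \<notin> {1..k}" for i g
    using approx_frame_vector_tendsto[of "(i, g)"] vout[OF that] by (simp add: LIMSEQ_const_iff)
  have win: "w (i, g) = \<pi> g (\<eta> i)" if i: "i \<in> {1..k}" for i g
  proof -
    have approx: "pop (newton n) (v (i, g)) = \<pi> g (pop (newton n) (c *\<^sub>R \<xi> i))" for n g
      using i by (simp add: vin pop_pi pop_scaleR_right linear)
    \<comment> \<open>Iterates commute with the isometry \<open>\<pi> g\<close>, so the error at g
      equals the error at the group identity, which tends to 0.\<close>
    have eq: "norm (pop (newton n) (v (i, g)) - \<pi> g (\<eta> i)) = norm (pop (newton n) (v (i, 0)) - w (i, 0))" for n
      unfolding approx \<eta> linear(4)[symmetric] unitary_norm[OF un] ..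
    have "(\<lambda>n. norm (pop (newton n) (v (i, g)) - \<pi> g (\<eta> i))) \<longlonglongrightarrow> 0"
      unfolding eq by (intro tendsto_norm_zero LIM_zero approx_frame_vector_tendsto)
    then have "(\<lambda>n. pop (newton n) (v (i, g))) \<longlonglongrightarrow> \<pi> g (\<eta> i)"
      by (rule LIM_zero_cancel[OF tendsto_norm_zero_cancel])
    with approx_frame_vector_tendsto show ?thesis
      by (rule LIMSEQ_unique)
  qed

  have Theta_\<eta>: "Theta k \<eta> \<pi> x = (\<lambda>i g. cinner x (w (i, g)))" for x
    by (auto simp: Theta_def fun_eq_iff win wout)
  \<comment> \<open>The real factor c moves from the argument onto the frame vectors; as c is
    nonzero, \<open>Theta k \<xi> \<pi>\<close> and the analysis map of \<open>v\<close> have the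
    same range.\<close>
  have Theta_\<xi>: "Theta k \<xi> \<pi> (c *\<^sub>R x) = (\<lambda>i g. cinner x (v (i, g)))" for x
    by (auto simp: Theta_def fun_eq_iff vin vout cinner_scaleR_left cinner_scaleR_right)
  have range_\<xi>: "\<exists>y. f = (\<lambda>i g. cinner y (v (i, g)))" if "f \<in> range (Theta k \<xi> \<pi>)" for f
  proof -
    from that obtain x where "f = Theta k \<xi> \<pi> x"
      by blast
    then have "f = Theta k \<xi> \<pi> (c *\<^sub>R ((1 / c) *\<^sub>R x))"
      using c by simp
    then show ?thesis
      unfolding Theta_\<xi> by blast
  qed
  have ell2k: "f \<in> ell2k k \<longleftrightarrow> (\<forall>i g. i \<notin> {1..k} \<longrightarrow> f i g = 0) \<and> sqsum (\<lambda>(i, g). f i g)"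
    for f :: "nat \<Rightarrow> 'g \<Rightarrow> complex"
    by (simp add: ell2k_def sqsum_def case_prod_unfold)
  have l2norm: "l2norm f = nrm2 (\<lambda>(i, g). f i g)" for f :: "nat \<Rightarrow> 'g \<Rightarrow> complex"
    by (simp add: l2norm_def nrm2_def case_prod_unfold)

  have "parseval_frame_for (\<lambda>(i, g). \<pi> g (\<eta> i)) ({1..k} \<times> UNIV) M"
    unfolding parseval_frame_for_def
  proof (intro conjI ballI)
    show "(\<lambda>(i, g). \<pi> g (\<eta> i)) ` ({1..k} \<times> UNIV) \<subseteq> M"
      using w_in_frame_space by (auto simp: M simp flip: win)
    fix x
    assume "x \<in> M"
    then have "((\<lambda>j. (cmod (cinner x (w j)))\<^sup>2) has_sum (norm x)\<^sup>2) UNIV"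
      using nrm2_has_sum[OF sqsum_w[of x]] by (simp add: nrm2_w M)
    also have "?this \<longleftrightarrow> ((\<lambda>j. (cmod (cinner x (case j of (i, g) \<Rightarrow> \<pi> g (\<eta> i))))\<^sup>2)
        has_sum (norm x)\<^sup>2) ({1..k} \<times> UNIV)"
    proof (rule has_sum_cong_neutral)
      show "(cmod (cinner x (w j)))\<^sup>2 = 0" if "j \<in> UNIV - {1..k} \<times> UNIV" for j
        using that wout by (cases j) auto
    qed (auto simp: win)
    finally show "((\<lambda>j. (cmod (cinner x (case j of (i, g) \<Rightarrow> \<pi> g (\<eta> i))))\<^sup>2)
        has_sum (norm x)\<^sup>2) ({1..k} \<times> UNIV)" .
  qed
  moreover have "range (Theta k \<eta> \<pi>) = closed_span_l2 k (range (Theta k \<xi> \<pi>))"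
  proof (intro equalityI subsetI)
    fix f
    assume "f \<in> range (Theta k \<eta> \<pi>)"
    then obtain x where f: "f = (\<lambda>i g. cinner x (w (i, g)))"
      by (auto simp: Theta_\<eta>)
    \<comment> \<open>The approximants are the analysis values of \<open>v\<close> at the iterates
      applied to x.\<close>
    have "\<exists>s\<in>range (Theta k \<xi> \<pi>). s \<in> ell2k k \<and> l2norm (f - s) < e" if e: "e > 0" for e
    proof -
      obtain n where n: "nrm2 (\<lambda>j. cinner x (w j) - cinner (pop (newton n) x) (v j)) \<le> e / 2"
        using analysis_w_approx[of "e / 2" x] e by auto
      have "l2norm (f - (\<lambda>i g. cinner (pop (newton n) x) (v (i, g)))) < e"
        using n e by (simp add: l2norm f case_prod_unfold)
      moreover have "(\<lambda>i g. cinner (pop (newton n) x) (v (i, g))) \<in> ell2k k"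
        using sqsum_coeff[of "pop (newton n) x"] by (simp add: ell2k vout case_prod_unfold)
      ultimately show ?thesis
        unfolding Theta_\<xi>[symmetric] by blast
    qed
    moreover have "f \<in> ell2k k"
      using sqsum_w[of x] by (simp add: ell2k f wout case_prod_unfold)
    ultimately show "f \<in> closed_span_l2 k (range (Theta k \<xi> \<pi>))"
      unfolding closed_span_l2_def span_range_Theta by (intro CollectI conjI allI impI)
  next
    fix f
    assume "f \<in> closed_span_l2 k (range (Theta k \<xi> \<pi>))"
    then have f: "f \<in> ell2k k"
      and appr: "\<And>e. e > 0 \<Longrightarrow> \<exists>s\<in>range (Theta k \<xi> \<pi>). l2norm (f - s) < e"
      unfolding closed_span_l2_def span_range_Theta by blast+
    have "\<exists>z. \<forall>j. (\<lambda>(i, g). f i g) j = cinner z (w j)"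
    proof (rule analysis_closure_in_range_w)
      show "sqsum (\<lambda>(i, g). f i g)"
        using f by (simp add: ell2k)
      fix e :: real
      assume "e > 0"
      then obtain s where s: "s \<in> range (Theta k \<xi> \<pi>)" "l2norm (f - s) < e"
        using appr by blast
      obtain y where "s = (\<lambda>i g. cinner y (v (i, g)))"
        using range_\<xi>[OF s(1)] by blast
      then show "\<exists>y. nrm2 (\<lambda>j. (case j of (i, g) \<Rightarrow> f i g) - cinner y (v j)) < e"
        using s(2) by (intro exI[of _ y]) (simp add: l2norm case_prod_unfold)
    qed
    then obtain z where "f = Theta k \<eta> \<pi> z"
      by (auto simp: Theta_\<eta> fun_eq_iff)
    then show "f \<in> range (Theta k \<eta> \<pi>)"
      by blast
  qed
  ultimately show ?thesis
    by blast
qed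

end
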